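(* Let $C$ be a set of untranslated join-irreducible permutations (of various sizes). A permutation $x\in S_n$ is contracted by $\mathcal{H}(C)_n$ if and only if for some $\gamma\in C$ there is a scramble $\sigma$ of $\gamma$ which occurs in $x$ with adjacent cliff.
   Context: $S_n$: permutations of $[n]$ in one-line notation $x_1\cdots x_n$ with the right weak order ($x\le y$ iff the set of inverted value pairs of $x$ is contained in that of $y$; covers swap adjacent entries to create an inversion), a lattice. A join-irreducible of $S_n$ is a permutation with exactly one descent $x_i>x_{i+1}$; it covers exactly one element $\gamma_*$. Its associated subset is $A=\{\gamma_{i+1},\dots,\gamma_n\}$ (where $i$ is the descent), $m=\min A$, $M=\max([n]\setminus A)$; $\gamma$ is the elements of $[n]\setminus A$ increasing followed by those of $A$ increasing. For $u\in S_p,v\in S_q$, $u\times v=u_1\cdots u_p(p+v_1)\cdots(p+v_q)$; $1_k$ is the identity of $S_k$. A permutation $x\in S_n$ is untranslated if $x_1>1$ and $x_n<n$; an untranslated join-irreducible $\gamma\in S_k$ has $\gamma_j=k$, $\gamma_{j+1}=1$ at its descent $j$. For such $\gamma$, a scramble is any $\sigma\in S_k$ with $\sigma_j=k$, $\sigma_{j+1}=1$ and $\{\sigma_1,..,\sigma_{j-1}\}=\{\gamma_1,..,\gamma_{j-1}\}$. A permutation $y\in S_k$ with $y_j=k,y_{j+1}=1$ occurs in $x\in S_n$ with adjacent cliff if there are $i_1<\dots<i_k$ with $x_{i_p}<x_{i_q}\iff y_p<y_q$ for all $p,q$, and $i_{j+1}=i_j+1$. A congruence $\Theta$ on $S_n$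 contracts $x$ if $x\equiv y$ for some $y$ covered by $x$; it contracts a join-irreducible $\gamma$ if $\gamma\equiv\gamma_*$. $\mathrm{st}(a_1..a_k)$ is the $u\in S_k$ with $u_i<u_j\iff a_i<a_j$. A family $\{\Theta_n\}_{n\ge0}$ of congruences on $S_n$ is translational if $u\times v\equiv u'\times v'$ mod $\Theta_{p+q}$ iff $u\equiv u'$ mod $\Theta_p$ and $v\equiv v'$ mod $\Theta_q$; insertional if for every $p$-subset $Q\subseteq[p+q]$, with $\varphi_Q(u,v)$ the unique $x\in S_{p+q}$ with $\{x_1..x_p\}=Q$, $\mathrm{st}(x_1..x_p)=u$, $\mathrm{st}(x_{p+1}..x_{p+q})=v$, we have $u\equiv u',v\equiv v'\Rightarrow\varphi_Q(u,v)\equiv\varphi_Q(u',v')$; an $\mathcal{H}$-family if both. $\{\mathcal{H}(C)_n\}_{n\ge0}$ is the smallest $\mathcal{H}$-family contracting every element of $C$. *)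

theory Defs
  imports Main
begin

text \<open>Permutations of [n] = {1..n} in one-line notation, as lists (entry x_i is x ! (i-1)).\<close>
definition perm :: "nat \<Rightarrow> nat list set" where
  "perm n = {x. length x = n \<and> distinct x \<and> set x = {1..n}}"

definition invs :: "nat list \<Rightarrow> (nat \<times> nat) set" where
  "invs x = {(a,b). a < b \<and> (\<exists>i j. i < j \<and> j < length x \<and> x ! i = b \<and> x ! j = a)}"

text \<open>Right weak order.\<close>
definition wle :: "nat list \<Rightarrow> nat list \<Rightarrow> bool" where
  "wle x y \<longleftrightarrow> invs x \<subseteq> invs y"

definition wlt :: "nat list \<Rightarrow> nat list \<Rightarrow> bool" where
  "wlt x y \<longleftrightarrow> wle x y \<and> x \<noteq> y"

definition covered_by :: "nat \<Rightarrow> nat list \<Rightarrow> nat list \<Rightarrow> bool" where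
  "covered_by n y x \<longleftrightarrow> y \<in> perm n \<and> x \<in> perm n \<and> wlt y x \<and>
     \<not> (\<exists>z \<in> perm n. wlt y z \<and> wlt z x)"

definition wjoin :: "nat \<Rightarrow> nat list \<Rightarrow> nat list \<Rightarrow> nat list" where
  "wjoin n x y = (THE z. z \<in> perm n \<and> wle x z \<and> wle y z \<and>
      (\<forall>w \<in> perm n. wle x w \<and> wle y w \<longrightarrow> wle z w))"

definition wmeet :: "nat \<Rightarrow> nat list \<Rightarrow> nat list \<Rightarrow> nat list" where
  "wmeet n x y = (THE z. z \<in> perm n \<and> wle z x \<and> wle z y \<and>
      (\<forall>w \<in> perm n. wle w x \<and> wle w y \<longrightarrow> wle w z))"

definition lattice_cong :: "nat \<Rightarrow> (nat list \<times> nat list) set \<Rightarrow> bool" where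
  "lattice_cong n \<Theta> \<longleftrightarrow> equiv (perm n) \<Theta> \<and>
     (\<forall>x y z. (x, y) \<in> \<Theta> \<and> z \<in> perm n \<longrightarrow>
        (wjoin n x z, wjoin n y z) \<in> \<Theta> \<and> (wmeet n x z, wmeet n y z) \<in> \<Theta>)"

definition contracts :: "nat \<Rightarrow> (nat list \<times> nat list) set \<Rightarrow> nat list \<Rightarrow> bool" where
  "contracts n \<Theta> x \<longleftrightarrow> (\<exists>y. covered_by n y x \<and> (x, y) \<in> \<Theta>)"

text \<open>Descents (0-based positions i with x_{i+1} > x_{i+2} in 1-based terms).\<close>
definition descents :: "nat list \<Rightarrow> nat set" where
  "descents x = {i. Suc i < length x \<and> x ! i > x ! Suc i}"

definition join_irreducible :: "nat list \<Rightarrow> bool" where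
  "join_irreducible x \<longleftrightarrow> card (descents x) = 1"

definition untranslated :: "nat list \<Rightarrow> bool" where
  "untranslated x \<longleftrightarrow> x \<noteq> [] \<and> hd x > 1 \<and> last x < length x"

definition ptimes :: "nat list \<Rightarrow> nat list \<Rightarrow> nat list" where
  "ptimes u v = u @ map (\<lambda>a. length u + a) v"

text \<open>phi_Q(u,v) for Q a p-subset of [p+q], p = length u, q = length v.\<close>
definition phiQ :: "nat set \<Rightarrow> nat list \<Rightarrow> nat list \<Rightarrow> nat list" where
  "phiQ Q u v =
     map (\<lambda>a. sorted_list_of_set Q ! (a - 1)) u @
     map (\<lambda>a. sorted_list_of_set ({1..length u + length v} - Q) ! (a - 1)) v"

type_synonym family = "nat \<Rightarrow> (nat list \<times> nat list) set"

definition translational :: "family \<Rightarrow> bool" where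
  "translational \<Theta> \<longleftrightarrow> (\<forall>p q u u' v v'. u \<in> perm p \<and> u' \<in> perm p \<and> v \<in> perm q \<and> v' \<in> perm q \<longrightarrow>
      ((ptimes u v, ptimes u' v') \<in> \<Theta> (p + q) \<longleftrightarrow> (u, u') \<in> \<Theta> p \<and> (v, v') \<in> \<Theta> q))"

definition insertional :: "family \<Rightarrow> bool" where
  "insertional \<Theta> \<longleftrightarrow> (\<forall>p q Q u u' v v'. Q \<subseteq> {1..p+q} \<and> card Q = p \<and>
      u \<in> perm p \<and> u' \<in> perm p \<and> v \<in> perm q \<and> v' \<in> perm q \<and>
      (u, u') \<in> \<Theta> p \<and> (v, v') \<in> \<Theta> q \<longrightarrow> (phiQ Q u v, phiQ Q u' v') \<in> \<Theta> (p + q))"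

definition H_family :: "family \<Rightarrow> bool" where
  "H_family \<Theta> \<longleftrightarrow> (\<forall>n. lattice_cong n (\<Theta> n)) \<and> translational \<Theta> \<and> insertional \<Theta>"

definition contracts_all :: "family \<Rightarrow> nat list set \<Rightarrow> bool" where
  "contracts_all \<Theta> C \<longleftrightarrow> (\<forall>\<gamma> \<in> C. contracts (length \<gamma>) (\<Theta> (length \<gamma>)) \<gamma>)"

text \<open>H(C): the smallest H-family contracting every element of C, i.e. the
  (componentwise) intersection of all such H-families.\<close>
definition HC :: "nat list set \<Rightarrow> family" where
  "HC C n = {(x, y). \<forall>\<Theta>. H_family \<Theta> \<and> contracts_all \<Theta> C \<longrightarrow> (x, y) \<in> \<Theta> n}"

text \<open>Scramble of gamma (untranslated join-irreducible in S_k, descent at 1-based j).\<close>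
definition scramble :: "nat list \<Rightarrow> nat list \<Rightarrow> bool" where
  "scramble \<gamma> \<sigma> \<longleftrightarrow> (let k = length \<gamma> in
     \<sigma> \<in> perm k \<and> (\<exists>j. j - 1 \<in> descents \<gamma> \<and> 1 \<le> j \<and>
        \<sigma> ! (j - 1) = k \<and> \<sigma> ! j = 1 \<and> set (take (j - 1) \<sigma>) = set (take (j - 1) \<gamma>)))"

text \<open>y \<in> S_k with y_j = k, y_{j+1} = 1 occurs in x with adjacent cliff
  (indices 0-based: i p is the position in x of the (p+1)-st pattern entry).\<close>
definition occurs_adj_cliff :: "nat list \<Rightarrow> nat list \<Rightarrow> bool" where
  "occurs_adj_cliff y x \<longleftrightarrow> (let k = length y in
     \<exists>j. 1 \<le> j \<and> j < k \<and> y ! (j - 1) = k \<and> y ! j = 1 \<and>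
     (\<exists>i :: nat \<Rightarrow> nat. (\<forall>p q. p < q \<and> q < k \<longrightarrow> i p < i q) \<and> (\<forall>p < k. i p < length x) \<and>
        (\<forall>p < k. \<forall>q < k. x ! i p < x ! i q \<longleftrightarrow> y ! p < y ! q) \<and>
        i j = Suc (i (j - 1))))"

end

theory Submission
  imports Defs
begin

text \<open>
  Whether a congruence of the weak order contracts a descent \<open>b a\<close> depends only on its arc: the pair
  \<open>a < b\<close> together with the set of intermediate values to its left. Reading the intermediate
  values as a word in two letters (left, right), an occurrence of a scramble of \<open>\<gamma>\<close> with adjacent
  cliff is an occurrence of the word of \<open>\<gamma>\<close> as a subword of the word of a descent. The arcs avoiding
  all words from \<open>C\<close> are closed under subarcs and subwords; closure under subarcs makes the
  equivalence "same avoiding join-irreducibles below" a lattice congruence, and closure under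
  subwords makes the family insertional and translational. Conversely, inserting entries on
  either side of \<open>\<gamma>\<close> produces every arc whose word contains that of \<open>\<gamma>\<close>.
\<close>

section \<open>Relative order of entries\<close>

text \<open>\<open>HC C\<close> is only bounded: from above by one explicit H-family,
  \<open>arc_cong C\<close>, and from below by an argument valid in every H-family contracting
  \<open>C\<close>.

  The obstacle in the upper bound is compatibility with joins. Lying above a given join-irreducible
  is a condition that meets respect; joins respect lying below a given meet-irreducible. The
  equivalence therefore needs both descriptions, and closure under subarcs is what makes them agree.

  Scrambles come from the lattice structure: two descents with the same values \<open>b a\<close>
  and the same set of values on each side are contracted together, whatever the order within the
  sides. Being untranslated means that the arc of \<gamma> joins 1 to k, so all other values are
  intermediate and its word records \<gamma> completely.\<close>

fun before :: "'a list \<Rightarrow> 'a \<Rightarrow> 'a \<Rightarrow> bool" where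
  "before [] s t \<longleftrightarrow> False"
| "before (h # xs) s t \<longleftrightarrow> s = h \<and> t \<in> set xs \<or> before xs s t"

lemma before_in_set: "before xs s t \<Longrightarrow> s \<in> set xs \<and> t \<in> set xs"
  by (induction xs) auto

lemma before_append:
  "before (xs @ ys) s t \<longleftrightarrow> before xs s t \<or> before ys s t \<or> s \<in> set xs \<and> t \<in> set ys"
  by (induction xs) auto

lemma before_map:
  assumes "inj_on f A" "set xs \<subseteq> A" "s \<in> A" "t \<in> A"
  shows "before (map f xs) (f s) (f t) \<longleftrightarrow> before xs s t"
  using assms(2) by (induction xs) (use assms in \<open>auto simp: inj_on_def\<close>)

lemma before_nth:
  "before xs s t \<longleftrightarrow> (\<exists>i j. i < j \<and> j < length xs \<and> xs ! i = s \<and> xs ! j = t)"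
proof (induction xs)
  case (Cons h xs)
  have "(\<exists>i j. i < j \<and> j < length (h # xs) \<and> (h # xs) ! i = s \<and> (h # xs) ! j = t)
    \<longleftrightarrow> s = h \<and> t \<in> set xs \<or> (\<exists>i j. i < j \<and> j < length xs \<and> xs ! i = s \<and> xs ! j = t)"
    (is "?L \<longleftrightarrow> ?R")
  proof
    assume ?L
    then obtain i j where ij: "i < j" "j < length (h # xs)" "(h # xs) ! i = s" "(h # xs) ! j = t"
      by blast
    then obtain j' where "j = Suc j'" by (cases j) auto
    with ij show ?R by (cases i) auto
  next
    assume ?R
    then show ?L
    proof
      assume "s = h \<and> t \<in> set xs"
      then obtain j where "j < length xs" "xs ! j = t" "s = h" by (auto simp: in_set_conv_nth)
      then show ?L by (intro exI[of _ 0] exI[of _ "Suc j"]) simp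
    next
      assume "\<exists>i j. i < j \<and> j < length xs \<and> xs ! i = s \<and> xs ! j = t"
      then obtain i j where "i < j" "j < length xs" "xs ! i = s" "xs ! j = t" by blast
      then show ?L by (intro exI[of _ "Suc i"] exI[of _ "Suc j"]) simp
    qed
  qed
  with Cons show ?case by simp
qed simp

lemma before_asym: "distinct xs \<Longrightarrow> before xs s t \<Longrightarrow> \<not> before xs t s"
  by (induction xs) (auto dest: before_in_set)

lemma before_irrefl: "distinct xs \<Longrightarrow> \<not> before xs s s"
  using before_asym by fast

lemma before_total:
  "s \<in> set xs \<Longrightarrow> t \<in> set xs \<Longrightarrow> s \<noteq> t \<Longrightarrow> before xs s t \<or> before xs t s"
  by (induction xs) auto

lemma before_trans: "distinct xs \<Longrightarrow> before xs s t \<Longrightarrow> before xs t u \<Longrightarrow> before xs s u"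
  by (induction xs) (auto dest: before_in_set)

lemma before_sorted_wrt: "sorted_wrt R xs \<Longrightarrow> before xs s t \<Longrightarrow> R s t"
  by (induction xs) auto

lemma before_inject:
  assumes "distinct xs" "distinct ys" "set xs = set ys" "\<And>s t. before xs s t \<Longrightarrow> before ys s t"
  shows "xs = ys"
  using assms
proof (induction xs arbitrary: ys)
  case (Cons h t)
  then obtain h' t' where ys: "ys = h' # t'" by (cases ys) auto
  have "h' = h"
  proof (rule ccontr)
    assume "h' \<noteq> h"
    then have "before ys h h'" using Cons.prems(3) by (intro Cons.prems(4)) (auto simp: ys)
    then show False using \<open>h' \<noteq> h\<close> Cons.prems(2) ys by (auto dest: before_in_set)
  qed
  moreover have "t = t'"
  proof (rule Cons.IH)
    show "set t = set t'"
      using Cons.prems(1-3) ys \<open>h' = h\<close> by (simp add: insert_ident)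
    fix s u assume "before t s u"
    then show "before t' s u"
      using Cons.prems(1) Cons.prems(4)[of s u] ys \<open>h' = h\<close> by (auto dest: before_in_set)
  qed (use Cons.prems ys in auto)
  ultimately show ?case using ys by simp
qed simp

text \<open>Insertion of one element \<open>a\<close>: everything related to \<open>a\<close> goes
  before it, the rest after, and a pair on opposite sides is in order by transitivity through
  \<open>a\<close>.\<close>

lemma ex_sorted_wrt_list:
  assumes "finite A"
    and "\<And>a b c. a \<in> A \<Longrightarrow> b \<in> A \<Longrightarrow> c \<in> A \<Longrightarrow> R a b \<Longrightarrow> R b c \<Longrightarrow> R a c"
    and "\<And>a b. a \<in> A \<Longrightarrow> b \<in> A \<Longrightarrow> a \<noteq> b \<Longrightarrow> R a b \<or> R b a"
  shows "\<exists>xs. distinct xs \<and> set xs = A \<and> sorted_wrt R xs"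
  using assms
proof (induction A rule: finite_induct)
  case (insert a A)
  have "\<exists>xs. distinct xs \<and> set xs = A \<and> sorted_wrt R xs"
    by (rule insert.IH) (use insert.prems in blast)+
  then obtain xs where xs: "distinct xs" "set xs = A" "sorted_wrt R xs"
    by blast
  let ?ys = "filter (\<lambda>b. R b a) xs @ a # filter (\<lambda>b. \<not> R b a) xs"
  have tot: "R a y" if "y \<in> A" "\<not> R y a" for y
    using insert.prems(2)[of a y] insert.hyps that by blast
  have "R x y" if "x \<in> A" "y \<in> A" "R x a" "\<not> R y a" for x y
    using insert.prems(1)[of x a y] tot[of y] that by blast
  then have "sorted_wrt R ?ys"
    using xs tot by (auto simp: sorted_wrt_append sorted_wrt_filter)
  moreover have "distinct ?ys" "set ?ys = insert a A"
    using xs insert.hyps by auto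
  ultimately show ?case by blast
qed simp

section \<open>The weak order as a lattice\<close>

lemma invs_iff: "(a, b) \<in> invs x \<longleftrightarrow> a < b \<and> before x b a"
  by (auto simp: invs_def before_nth)

lemma permD:
  assumes "x \<in> perm n"
  shows "length x = n" "distinct x" "set x = {1..n}"
  using assms by (auto simp: perm_def)

lemma permI: "distinct x \<Longrightarrow> set x = {1..n} \<Longrightarrow> x \<in> perm n"
  using distinct_card[of x] by (auto simp: perm_def)

lemma invs_inject:
  assumes "x \<in> perm n" "y \<in> perm n" "invs x = invs y"
  shows "x = y"
proof (rule before_inject)
  fix s t assume st: "before x s t"
  note x = permD[OF assms(1)] and y = permD[OF assms(2)]
  have in_y: "s \<in> set y" "t \<in> set y" using before_in_set[OF st] x y by auto
  have "s \<noteq> t" using st before_irrefl x by metis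
  then consider "s < t" | "t < s" by linarith
  then show "before y s t"
  proof cases
    case 1
    then have "(s, t) \<notin> invs y"
      using before_asym[OF x(2) st] assms(3) invs_iff by blast
    then show ?thesis using before_total[OF in_y \<open>s \<noteq> t\<close>] 1 by (auto simp: invs_iff)
  next
    case 2
    then have "(t, s) \<in> invs y" using st assms(3)[symmetric] by (simp add: invs_iff)
    then show ?thesis by (simp add: invs_iff)
  qed
qed (use assms permD in auto)

section \<open>Biclosed sets as inversion sets\<close>

definition pairs :: "nat \<Rightarrow> (nat \<times> nat) set" where
  "pairs n = {(a, b). 1 \<le> a \<and> a < b \<and> b \<le> n}"

text \<open>The closure conditions are transitivity of \<open>I\<close> and of its complement in
  \<open>pairs n\<close>. They characterise the inversion sets of permutations, so weak-order
  arguments can be made on sets of pairs.\<close>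

definition biclosed :: "nat \<Rightarrow> (nat \<times> nat) set \<Rightarrow> bool" where
  "biclosed n I \<longleftrightarrow> I \<subseteq> pairs n \<and>
     (\<forall>a b c. (a, b) \<in> I \<and> (b, c) \<in> I \<longrightarrow> (a, c) \<in> I) \<and>
     (\<forall>a b c. (a, c) \<in> I \<and> a < b \<and> b < c \<longrightarrow> (a, b) \<in> I \<or> (b, c) \<in> I)"

lemma biclosed_subset: "biclosed n I \<Longrightarrow> I \<subseteq> pairs n"
  by (simp add: biclosed_def)

lemma biclosed_trans: "biclosed n I \<Longrightarrow> (a, b) \<in> I \<Longrightarrow> (b, c) \<in> I \<Longrightarrow> (a, c) \<in> I"
  unfolding biclosed_def by blast

lemma biclosed_cotrans:
  "biclosed n I \<Longrightarrow> (a, c) \<in> I \<Longrightarrow> a < b \<Longrightarrow> b < c \<Longrightarrow> (a, b) \<in> I \<or> (b, c) \<in> I"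
  unfolding biclosed_def by blast

lemma biclosed_compl:
  assumes "biclosed n I"
  shows "biclosed n (pairs n - I)"
proof -
  have "(a, c) \<in> pairs n - I" if "(a, b) \<in> pairs n - I" "(b, c) \<in> pairs n - I" for a b c
  proof -
    have "(a, c) \<in> pairs n" "a < b" "b < c" using that by (auto simp: pairs_def)
    then show ?thesis using that biclosed_cotrans[OF assms, of a c b] by auto
  qed
  moreover have "(a, b) \<in> pairs n - I \<or> (b, c) \<in> pairs n - I"
    if "(a, c) \<in> pairs n - I" "a < b" "b < c" for a b c
  proof -
    have "(a, b) \<in> pairs n" "(b, c) \<in> pairs n" using that by (auto simp: pairs_def)
    then show ?thesis using that biclosed_trans[OF assms, of a b c] by auto
  qed
  ultimately show ?thesis unfolding biclosed_def by blast
qed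

lemma biclosed_invs:
  assumes "x \<in> perm n"
  shows "biclosed n (invs x)"
  unfolding biclosed_def
proof (intro conjI allI impI)
  note x = permD[OF assms]
  show sub: "invs x \<subseteq> pairs n"
    using x(3) by (auto simp: invs_iff pairs_def dest!: before_in_set)
  show "(a, c) \<in> invs x" if "(a, b) \<in> invs x \<and> (b, c) \<in> invs x" for a b c
    using that before_trans[OF x(2), of c b a] by (auto simp: invs_iff)
  show "(a, b) \<in> invs x \<or> (b, c) \<in> invs x" if h: "(a, c) \<in> invs x \<and> a < b \<and> b < c" for a b c
  proof -
    have ca: "before x c a" using h by (simp add: invs_iff)
    have "a \<in> set x" "c \<in> set x" using before_in_set[OF ca] by auto
    then have b: "b \<in> set x" using h x(3) by auto
    show ?thesis
    proof (cases "before x b a")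
      case False
      then have "before x a b" using before_total[OF b \<open>a \<in> set x\<close>] h by blast
      then show ?thesis using before_trans[OF x(2) ca] h by (simp add: invs_iff)
    qed (use h in \<open>simp add: invs_iff\<close>)
  qed
qed

lemma biclosed_ex_perm:
  assumes "biclosed n I"
  shows "\<exists>x \<in> perm n. invs x = I"
proof -
  \<comment> \<open>\<open>R s t\<close> says that s is to stand left of t. For each of the six
    relative orders of three values, transitivity of \<open>R\<close> is one of the two closure
    conditions.\<close>
  define R where "R s t \<longleftrightarrow> s < t \<and> (s, t) \<notin> I \<or> t < s \<and> (t, s) \<in> I" for s t :: nat
  note tr = biclosed_trans[OF assms] and co = biclosed_cotrans[OF assms]
  have sub: "1 \<le> a \<and> a < b \<and> b \<le> n" if "(a, b) \<in> I" for a b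
    using biclosed_subset[OF assms] that by (auto simp: pairs_def)
  have R_trans: "R a c" if "R a b" "R b c" for a b c
  proof -
    have "a \<noteq> c" "a \<noteq> b" "b \<noteq> c" using that by (auto simp: R_def)
    then consider "a < b" "b < c" | "a < c" "c < b" | "b < a" "a < c"
      | "b < c" "c < a" | "c < a" "a < b" | "c < b" "b < a"
      by linarith
    then show ?thesis
    proof cases
      case 1
      then show ?thesis using that co[of a c b] by (auto simp: R_def)
    next
      case 2
      then show ?thesis using that tr[of a c b] by (auto simp: R_def)
    next
      case 3
      then show ?thesis using that tr[of b a c] by (auto simp: R_def)
    next
      case 4
      then show ?thesis using that co[of b a c] by (auto simp: R_def)
    next
      case 5
      then show ?thesis using that co[of c b a] by (auto simp: R_def)
    next
      case 6
      then show ?thesis using that tr[of c b a] by (auto simp: R_def)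
    qed
  qed
  have "a \<noteq> b \<Longrightarrow> R a b \<or> R b a" for a b
    unfolding R_def by linarith
  then have "\<exists>xs. distinct xs \<and> set xs = {1..n} \<and> sorted_wrt R xs"
    by (intro ex_sorted_wrt_list) (use R_trans in blast)+
  then obtain xs where xs: "distinct xs" "set xs = {1..n}" "sorted_wrt R xs"
    by blast
  have "(a, b) \<in> invs xs \<longleftrightarrow> (a, b) \<in> I" for a b
  proof
    assume "(a, b) \<in> invs xs"
    then show "(a, b) \<in> I" using before_sorted_wrt[OF xs(3), of b a] by (auto simp: invs_iff R_def)
  next
    assume ab: "(a, b) \<in> I"
    then have "\<not> R a b" using sub[of a b] sub[of b a] unfolding R_def by linarith
    then have "before xs b a"
      using before_total[of a xs b] before_sorted_wrt[OF xs(3), of a b] sub[OF ab] xs(2) by auto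
    then show "(a, b) \<in> invs xs" using sub[OF ab] by (simp add: invs_iff)
  qed
  then have "invs xs = I" by auto
  with xs permI show ?thesis by blast
qed

text \<open>The classical formula for joins in the weak order. Cotransitivity survives by induction
  along the chain: the splitting value b lies below the last inner vertex, equals it, or lies inside
  the last edge, where cotransitivity of \<open>I\<close> or \<open>J\<close> applies.\<close>

lemma biclosed_trancl_Un:
  assumes "biclosed n I" "biclosed n J"
  shows "biclosed n ((I \<union> J)\<^sup>+)"
  unfolding biclosed_def
proof (intro conjI allI impI)
  let ?E = "I \<union> J"
  have co: "(a, b) \<in> ?E \<or> (b, c) \<in> ?E" if "(a, c) \<in> ?E" "a < b" "b < c" for a b c
    using that biclosed_cotrans[OF assms(1), of a c b] biclosed_cotrans[OF assms(2), of a c b]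
    by auto
  have "(a, b) \<in> ?E\<^sup>+ \<Longrightarrow> (a, b) \<in> pairs n" for a b
  proof (induction rule: trancl_induct)
    case (step y z)
    then have "(y, z) \<in> pairs n" using assms[THEN biclosed_subset] by blast
    with step show ?case by (auto simp: pairs_def)
  qed (use assms[THEN biclosed_subset] in auto)
  then show "?E\<^sup>+ \<subseteq> pairs n" by auto
  show "(a, c) \<in> ?E\<^sup>+" if "(a, b) \<in> ?E\<^sup>+ \<and> (b, c) \<in> ?E\<^sup>+" for a b c
    using that by auto
  have "(a, c) \<in> ?E\<^sup>+ \<Longrightarrow> a < b \<Longrightarrow> b < c \<Longrightarrow> (a, b) \<in> ?E\<^sup>+ \<or> (b, c) \<in> ?E\<^sup>+" for a b c
  proof (induction rule: trancl_induct)
    case (base c)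
    then show ?case using co by blast
  next
    case (step y z)
    consider "b < y" | "b = y" | "y < b" by linarith
    then show ?case
    proof cases
      case 1
      then have "(a, b) \<in> ?E\<^sup>+ \<or> (b, y) \<in> ?E\<^sup>+" using step by blast
      then show ?thesis using step(2) by (blast intro: trancl_into_trancl)
    next
      case 2
      then show ?thesis using step by simp
    next
      case 3
      then have "(y, b) \<in> ?E \<or> (b, z) \<in> ?E" using step(2,5) co by blast
      then show ?thesis using step(1) by (blast intro: trancl_into_trancl)
    qed
  qed
  then show "(a, b) \<in> ?E\<^sup>+ \<or> (b, c) \<in> ?E\<^sup>+" if "(a, c) \<in> ?E\<^sup>+ \<and> a < b \<and> b < c" for a b c
    using that by blast
qed

section \<open>Joins and meets through inversion sets\<close>

lemma wjoin_eqI: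
  assumes "z \<in> perm n" "wle x z" "wle y z" "\<And>w. w \<in> perm n \<Longrightarrow> wle x w \<Longrightarrow> wle y w \<Longrightarrow> wle z w"
  shows "wjoin n x y = z"
  unfolding wjoin_def
proof (rule the_equality)
  fix w assume w: "w \<in> perm n \<and> wle x w \<and> wle y w \<and> (\<forall>v \<in> perm n. wle x v \<and> wle y v \<longrightarrow> wle w v)"
  have a: "w \<in> perm n" using w by blast
  have b: "wle w z" using w assms(1-3) by blast
  have c: "wle z w" using w assms(4)[of w] by blast
  have "invs w = invs z" using b c unfolding wle_def by (rule subset_antisym)
  with a assms(1) show "w = z" by (rule invs_inject)
next
  show "z \<in> perm n \<and> wle x z \<and> wle y z \<and> (\<forall>w \<in> perm n. wle x w \<and> wle y w \<longrightarrow> wle z w)"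
    using assms by simp
qed

lemma wmeet_eqI:
  assumes "z \<in> perm n" "wle z x" "wle z y" "\<And>w. w \<in> perm n \<Longrightarrow> wle w x \<Longrightarrow> wle w y \<Longrightarrow> wle w z"
  shows "wmeet n x y = z"
  unfolding wmeet_def
proof (rule the_equality)
  fix w assume w: "w \<in> perm n \<and> wle w x \<and> wle w y \<and> (\<forall>v \<in> perm n. wle v x \<and> wle v y \<longrightarrow> wle v w)"
  have a: "w \<in> perm n" using w by blast
  have c: "wle z w" using w assms(1-3) by blast
  have b: "wle w z" using w assms(4)[of w] by blast
  have "invs w = invs z" using b c unfolding wle_def by (rule subset_antisym)
  with a assms(1) show "w = z" by (rule invs_inject)
next
  show "z \<in> perm n \<and> wle z x \<and> wle z y \<and> (\<forall>w \<in> perm n. wle w x \<and> wle w y \<longrightarrow> wle w z)"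
    using assms by simp
qed

lemma trancl_subset_biclosed:
  assumes "biclosed n K" "E \<subseteq> K"
  shows "E\<^sup>+ \<subseteq> K"
proof -
  have "trans K"
  proof (rule transI)
    show "(a, c) \<in> K" if "(a, b) \<in> K" "(b, c) \<in> K" for a b c
      using biclosed_trans[OF assms(1) that] .
  qed
  then show ?thesis using trancl_mono_subset[OF assms(2)] by simp
qed

lemma r_into_trancl_subset: "r \<subseteq> r\<^sup>+"
  by auto

lemma wjoin_perm:
  assumes "x \<in> perm n" "y \<in> perm n"
  shows "wjoin n x y \<in> perm n" "invs (wjoin n x y) = (invs x \<union> invs y)\<^sup>+"
proof -
  obtain z where z: "z \<in> perm n" "invs z = (invs x \<union> invs y)\<^sup>+"
    using biclosed_ex_perm[OF biclosed_trancl_Un[OF biclosed_invs[OF assms(1)] biclosed_invs[OF assms(2)]]]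
    by blast
  have "invs x \<union> invs y \<subseteq> invs z" unfolding z(2) by (rule r_into_trancl_subset)
  have "wjoin n x y = z"
  proof (rule wjoin_eqI)
    fix w assume w: "w \<in> perm n" "wle x w" "wle y w"
    then show "wle z w"
      using trancl_subset_biclosed[OF biclosed_invs[OF w(1)], of "invs x \<union> invs y"]
      unfolding wle_def z(2) by blast
  qed (use z(1) \<open>invs x \<union> invs y \<subseteq> invs z\<close> in \<open>simp_all add: wle_def\<close>)
  with z show "wjoin n x y \<in> perm n" "invs (wjoin n x y) = (invs x \<union> invs y)\<^sup>+" by simp_all
qed

text \<open>Complementation reverses the order and preserves biclosedness, so the join formula
  applies to the non-inversions.\<close>

lemma wmeet_perm:
  assumes "x \<in> perm n" "y \<in> perm n"
  shows "wmeet n x y \<in> perm n"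
    "pairs n - invs (wmeet n x y) = ((pairs n - invs x) \<union> (pairs n - invs y))\<^sup>+"
proof -
  define T where "T = ((pairs n - invs x) \<union> (pairs n - invs y))\<^sup>+"
  have T: "biclosed n T"
    unfolding T_def
    by (intro biclosed_trancl_Un biclosed_compl biclosed_invs assms)
  obtain z where z: "z \<in> perm n" "invs z = pairs n - T"
    using biclosed_ex_perm[OF biclosed_compl[OF T]] by blast
  have sub: "(pairs n - invs x) \<union> (pairs n - invs y) \<subseteq> T"
    unfolding T_def by (rule r_into_trancl_subset)
  have "wmeet n x y = z"
  proof (rule wmeet_eqI)
    fix w assume w: "w \<in> perm n" "wle w x" "wle w y"
    have "T \<subseteq> pairs n - invs w"
      unfolding T_def
      by (rule trancl_subset_biclosed[OF biclosed_compl[OF biclosed_invs[OF w(1)]]])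
        (use w in \<open>auto simp: wle_def\<close>)
    then show "wle w z"
      using biclosed_subset[OF biclosed_invs[OF w(1)]] unfolding wle_def z(2) by blast
  qed (use z sub in \<open>auto simp: wle_def\<close>)
  moreover have "T \<subseteq> pairs n" using T by (rule biclosed_subset)
  ultimately show "wmeet n x y \<in> perm n"
    "pairs n - invs (wmeet n x y) = ((pairs n - invs x) \<union> (pairs n - invs y))\<^sup>+"
    unfolding T_def[symmetric] using z by auto
qed

section \<open>Arcs and the congruences they define\<close>

text \<open>
  An arc is a triple \<open>(a, b, L)\<close> with \<open>a < b\<close>, where \<open>L\<close> only matters inside \<open>{a<..<b}\<close>. A descent
  \<open>b a\<close> of a permutation has the arc whose \<open>L\<close> is the set of values to the left of the descent.
  The set \<open>arc_set a b (- L)\<close> is the inversion set of the join-irreducible permutation with that arc,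
  and \<open>arc_set a b L\<close> is the complement of the inversion set of the corresponding meet-irreducible.
\<close>

definition arc_set :: "nat \<Rightarrow> nat \<Rightarrow> nat set \<Rightarrow> (nat \<times> nat) set" where
  "arc_set a b S = {(c, d). a \<le> c \<and> c < d \<and> d \<le> b \<and> (c \<in> S \<or> c = a) \<and> (d \<notin> S \<or> d = b)}"

lemma arc_set_mono: "(c, d) \<in> arc_set a b S \<Longrightarrow> arc_set c d S \<subseteq> arc_set a b S"
  by (auto simp: arc_set_def)

text \<open>A path in \<open>E\<close> that starts at a or at a value of \<open>S\<close> stays in
  \<open>S\<close> and avoids b as long as it does not exceed b, since the first edge violating this
  would lie in the arc set. Hence a join or a meet creates no new intersection with an arc
  set.\<close>

lemma arc_set_trancl:
  assumes "E \<subseteq> pairs n" "arc_set a b S \<inter> E = {}"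
  shows "arc_set a b S \<inter> E\<^sup>+ = {}"
proof -
  have "d \<le> b \<longrightarrow> d \<in> S \<and> d \<noteq> b" if "(c, d) \<in> E\<^sup>+" "a \<le> c" "c \<in> S \<or> c = a" for c d
    using that(1)
  proof (induction rule: trancl_induct)
    case (base d)
    then have "c < d" "(c, d) \<notin> arc_set a b S" using assms by (auto simp: pairs_def)
    then show ?case using that by (auto simp: arc_set_def)
  next
    case (step y z)
    have "c < y"
      using trancl_subset_biclosed[of n "pairs n" E] assms(1) step(1)
      by (auto simp: biclosed_def pairs_def)
    have "y < z" "(y, z) \<notin> arc_set a b S" using step(2) assms by (auto simp: pairs_def)
    then show ?case using step(3) \<open>c < y\<close> that by (auto simp: arc_set_def)
  qed
  then show ?thesis by (fastforce simp: arc_set_def)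
qed

text \<open>
  For a family of arcs closed under taking subarcs, the join-irreducibles below a permutation
  determine the meet-irreducibles above it: a shortest arc violating this has \<open>(a, b)\<close> as its only
  offending inversion, and then the inversion set contains the whole join-irreducible of the arc.
\<close>

lemma arc_set_dual_aux:
  assumes "biclosed n J"
    and sub: "\<And>a b c d L. ok a b L \<Longrightarrow> a \<le> c \<Longrightarrow> d \<le> b \<Longrightarrow> ok c d L"
    and JI: "\<And>a b L. ok a b L \<Longrightarrow> arc_set a b (- L) \<subseteq> J \<Longrightarrow> arc_set a b (- L) \<subseteq> I"
    and "ok a b L" "arc_set a b L \<inter> I = {}"
  shows "arc_set a b L \<inter> J = {}"
  using assms(4,5)
proof (induction "b - a" arbitrary: a b rule: less_induct)
  case less
  show ?case
  proof (rule ccontr)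
    assume "arc_set a b L \<inter> J \<noteq> {}"
    then obtain c d where cd: "(c, d) \<in> arc_set a b L" "(c, d) \<in> J" by auto
    have only: "c' = a \<and> d' = b" if cd': "(c', d') \<in> arc_set a b L" "(c', d') \<in> J" for c' d'
    proof (rule ccontr)
      assume "\<not> (c' = a \<and> d' = b)"
      moreover have le: "a \<le> c'" "c' < d'" "d' \<le> b" using cd'(1) by (auto simp: arc_set_def)
      ultimately have "d' - c' < b - a" by linarith
      moreover have "ok c' d' L" using sub less.prems(1) le by blast
      moreover have "arc_set c' d' L \<inter> I = {}" using arc_set_mono[OF cd'(1)] less.prems(2) by blast
      ultimately have "arc_set c' d' L \<inter> J = {}" by (rule less.hyps)
      moreover have "(c', d') \<in> arc_set c' d' L" using le by (simp add: arc_set_def)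
      ultimately show False using cd'(2) by blast
    qed
    have abJ: "(a, b) \<in> J" and ab: "(a, b) \<in> arc_set a b L" "a < b"
      using cd only[OF cd] by (auto simp: arc_set_def)
    \<comment> \<open>Cotransitivity of \<open>J\<close> splits (a, b) at each intermediate value.
      One half lies in \<open>arc_set a b L\<close> and is excluded by \<open>only\<close>, so the
      other half is in \<open>J\<close>.\<close>
    have r: "(r, b) \<in> J" if "a < r" "r < b" "r \<notin> L" for r
    proof -
      have "(a, r) \<in> arc_set a b L" using that by (auto simp: arc_set_def)
      then have "(a, r) \<notin> J" using only that by blast
      then show ?thesis using biclosed_cotrans[OF assms(1) abJ] that by blast
    qed
    have l: "(a, l) \<in> J" if "a < l" "l < b" "l \<in> L" for l
    proof -
      have "(l, b) \<in> arc_set a b L" using that by (auto simp: arc_set_def)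
      then have "(l, b) \<notin> J" using only that by blast
      then show ?thesis using biclosed_cotrans[OF assms(1) abJ] that by blast
    qed
    have rl: "(r, l) \<in> J" if "a < r" "r < l" "l < b" "r \<notin> L" "l \<in> L" for r l
    proof -
      have "(a, r) \<in> arc_set a b L" using that by (auto simp: arc_set_def)
      then have "(a, r) \<notin> J" using only that by fastforce
      then show ?thesis using biclosed_cotrans[OF assms(1) l[of l], of r] that by auto
    qed
    have "arc_set a b (- L) \<subseteq> J"
    proof clarify
      fix e f assume "(e, f) \<in> arc_set a b (- L)"
      then have ef: "a \<le> e" "e < f" "f \<le> b" "e \<notin> L \<or> e = a" "f \<in> L \<or> f = b"
        by (auto simp: arc_set_def)
      consider "e = a" "f = b" | "e = a" "f < b" | "a < e" "f = b" | "a < e" "f < b"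
        using ef by linarith
      then show "(e, f) \<in> J"
        using abJ r l rl ef by cases auto
    qed
    then have "arc_set a b (- L) \<subseteq> I" using JI less.prems(1) by blast
    moreover have "(a, b) \<in> arc_set a b (- L)" using ab(2) by (simp add: arc_set_def)
    ultimately show False using less.prems(2) ab(1) by blast
  qed
qed

text \<open>One implication is the auxiliary lemma used in both directions between \<open>I\<close>
  and \<open>J\<close>. For the other, passing to complements in \<open>pairs n\<close> and
  replacing \<open>L\<close> by \<open>- L\<close> exchanges join-irreducibles below with
  meet-irreducibles above, and the same lemma applies.\<close>

lemma arc_set_dual:
  assumes "biclosed n I" "biclosed n J"
    and sub: "\<And>a b c d L. ok a b L \<Longrightarrow> a \<le> c \<Longrightarrow> d \<le> b \<Longrightarrow> ok c d L"
  shows "(\<forall>a b L. ok a b L \<longrightarrow> (arc_set a b (- L) \<subseteq> I \<longleftrightarrow> arc_set a b (- L) \<subseteq> J))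
    \<longleftrightarrow> (\<forall>a b L. ok a b L \<longrightarrow> (arc_set a b L \<inter> I = {} \<longleftrightarrow> arc_set a b L \<inter> J = {}))"
    (is "?L \<longleftrightarrow> ?R")
proof
  assume h: ?L
  show ?R
  proof (intro allI impI iffI)
    fix a b L assume ok: "ok a b L"
    show "arc_set a b L \<inter> J = {}" if "arc_set a b L \<inter> I = {}"
      by (rule arc_set_dual_aux[OF assms(2), of ok I]) (use sub h ok that in blast)+
    show "arc_set a b L \<inter> I = {}" if "arc_set a b L \<inter> J = {}"
      by (rule arc_set_dual_aux[OF assms(1), of ok J]) (use sub h ok that in blast)+
  qed
next
  assume h: ?R
  have *: "A \<subseteq> pairs n - K \<longleftrightarrow> A \<subseteq> pairs n \<and> A \<inter> K = {}"
    and **: "A \<inter> (pairs n - K) = {} \<longleftrightarrow> A \<inter> pairs n \<subseteq> K" for A K :: "(nat \<times> nat) set"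
    by blast+
  let ?ok = "\<lambda>a b L. ok a b (- L)"
  have sub': "?ok c d L" if "?ok a b L" "a \<le> c" "d \<le> b" for a b c d L
    using sub that by blast
  show ?L
  proof (intro allI impI iffI)
    fix a b L assume ok: "ok a b L"
    then have ok': "?ok a b (- L)" by simp
    have h': "arc_set e f (- M) \<subseteq> pairs n - I \<longleftrightarrow> arc_set e f (- M) \<subseteq> pairs n - J"
      if "?ok e f M" for e f M
      using h that unfolding * by blast
    show "arc_set a b (- L) \<subseteq> J" if I: "arc_set a b (- L) \<subseteq> I"
    proof -
      have "arc_set a b (- L) \<inter> (pairs n - J) = {}"
        by (rule arc_set_dual_aux[OF biclosed_compl[OF assms(2)], of ?ok "pairs n - I"])
          (use sub' h' ok' I in blast)+
      then show ?thesis using I biclosed_subset[OF assms(1)] by blast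
    qed
    show "arc_set a b (- L) \<subseteq> I" if J: "arc_set a b (- L) \<subseteq> J"
    proof -
      have "arc_set a b (- L) \<inter> (pairs n - I) = {}"
        by (rule arc_set_dual_aux[OF biclosed_compl[OF assms(1)], of ?ok "pairs n - J"])
          (use sub' h' ok' J in blast)+
      then show ?thesis using J biclosed_subset[OF assms(2)] by blast
    qed
  qed
qed

section \<open>Words, embeddings and the congruence of avoiding arcs\<close>

definition left_values :: "nat list \<Rightarrow> nat set" where
  "left_values \<gamma> = set (takeWhile (\<lambda>v. v \<noteq> length \<gamma>) \<gamma>)"

text \<open>The map \<open>f\<close> is an occurrence of the word of \<gamma> as a subword:
  increasing on the intermediate values and preserving the letters left and right. The extreme
  values are left out because they correspond to a and b themselves.\<close>

definition embeds :: "nat list \<Rightarrow> nat \<Rightarrow> nat \<Rightarrow> nat set \<Rightarrow> bool" where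
  "embeds \<gamma> a b L \<longleftrightarrow> (\<exists>f. strict_mono_on {1<..<length \<gamma>} f \<and>
     (\<forall>v \<in> {1<..<length \<gamma>}. f v \<in> {a<..<b} \<and> (f v \<in> L \<longleftrightarrow> v \<in> left_values \<gamma>)))"

definition avoiding :: "nat list set \<Rightarrow> nat \<Rightarrow> nat \<Rightarrow> nat set \<Rightarrow> bool" where
  "avoiding C a b L \<longleftrightarrow> (\<forall>\<gamma> \<in> C. \<not> embeds \<gamma> a b L)"

text \<open>Arcs range over all naturals, uniformly in n. If a < b but the arc leaves {1..n}, its
  arc set contains (a, b) and lies below no permutation of [n]; otherwise, for b at most a, the arc
  set is empty. Either way the condition holds trivially.\<close>

definition arc_cong :: "nat list set \<Rightarrow> family" where
  "arc_cong C n = {(x, y). x \<in> perm n \<and> y \<in> perm n \<and>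
     (\<forall>a b L. avoiding C a b L \<longrightarrow> (arc_set a b (- L) \<subseteq> invs x \<longleftrightarrow> arc_set a b (- L) \<subseteq> invs y))}"

lemma embeds_mono: "embeds \<gamma> c d L \<Longrightarrow> a \<le> c \<Longrightarrow> d \<le> b \<Longrightarrow> embeds \<gamma> a b L"
  unfolding embeds_def by fastforce

text \<open>Read contrapositively: the arc pulled back along an increasing map \<open>g\<close>
  avoids whatever the image arc avoids. This is the closure under subwords.\<close>

lemma embeds_image:
  assumes "embeds \<gamma> c d (g -` L)" "strict_mono_on {c..d} g"
  shows "embeds \<gamma> (g c) (g d) L"
proof -
  obtain f where f: "strict_mono_on {1<..<length \<gamma>} f"
    "\<And>v. v \<in> {1<..<length \<gamma>} \<Longrightarrow> f v \<in> {c<..<d} \<and> (f v \<in> g -` L \<longleftrightarrow> v \<in> left_values \<gamma>)"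
    using assms(1) unfolding embeds_def by blast
  have "strict_mono_on {1<..<length \<gamma>} (g \<circ> f)"
  proof (rule strict_mono_onI)
    fix r s assume rs: "r \<in> {1<..<length \<gamma>}" "s \<in> {1<..<length \<gamma>}" "r < s"
    show "(g \<circ> f) r < (g \<circ> f) s"
      using strict_mono_onD[OF f(1) rs] f(2)[OF rs(1)] f(2)[OF rs(2)]
        strict_mono_onD[OF assms(2), of "f r" "f s"] by simp
  qed
  moreover have "(g \<circ> f) v \<in> {g c<..<g d} \<and> ((g \<circ> f) v \<in> L \<longleftrightarrow> v \<in> left_values \<gamma>)"
    if "v \<in> {1<..<length \<gamma>}" for v
    using f(2)[OF that] strict_mono_onD[OF assms(2), of c "f v"]
      strict_mono_onD[OF assms(2), of "f v" d] by auto
  ultimately show ?thesis unfolding embeds_def by blast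
qed

lemma avoiding_mono: "avoiding C a b L \<Longrightarrow> a \<le> c \<Longrightarrow> d \<le> b \<Longrightarrow> avoiding C c d L"
  unfolding avoiding_def using embeds_mono by blast

lemma arc_cong_dual:
  assumes "x \<in> perm n" "y \<in> perm n"
  shows "(x, y) \<in> arc_cong C n \<longleftrightarrow>
    (\<forall>a b L. avoiding C a b L \<longrightarrow> (arc_set a b L \<inter> invs x = {} \<longleftrightarrow> arc_set a b L \<inter> invs y = {}))"
  using arc_set_dual[OF assms[THEN biclosed_invs], of "avoiding C"] avoiding_mono assms
  unfolding arc_cong_def by blast

lemma equiv_arc_cong: "equiv (perm n) (arc_cong C n)"
  by (rule equivI) (auto simp: arc_cong_def refl_on_def sym_def trans_def)

lemma arc_set_disjoint_wjoin:
  assumes "x \<in> perm n" "y \<in> perm n"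
  shows "arc_set a b L \<inter> invs (wjoin n x y) = {} \<longleftrightarrow>
    arc_set a b L \<inter> invs x = {} \<and> arc_set a b L \<inter> invs y = {}"
proof -
  let ?E = "invs x \<union> invs y"
  have "?E \<subseteq> pairs n" using assms[THEN biclosed_invs, THEN biclosed_subset] by blast
  then have "arc_set a b L \<inter> ?E\<^sup>+ = {} \<longleftrightarrow> arc_set a b L \<inter> ?E = {}"
    using arc_set_trancl[of ?E n a b L] r_into_trancl_subset[of ?E] by blast
  then show ?thesis unfolding wjoin_perm(2)[OF assms] by blast
qed

lemma arc_set_subset_wmeet:
  assumes "x \<in> perm n" "y \<in> perm n"
  shows "arc_set a b L \<subseteq> invs (wmeet n x y) \<longleftrightarrow>
    arc_set a b L \<subseteq> invs x \<and> arc_set a b L \<subseteq> invs y"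
proof -
  let ?E = "(pairs n - invs x) \<union> (pairs n - invs y)"
  have eq: "A \<subseteq> invs z \<longleftrightarrow> A \<subseteq> pairs n \<and> A \<inter> (pairs n - invs z) = {}"
    if "z \<in> perm n" for A z
    using biclosed_subset[OF biclosed_invs[OF that]] by blast
  have "arc_set a b L \<inter> ?E\<^sup>+ = {} \<longleftrightarrow> arc_set a b L \<inter> ?E = {}"
    using arc_set_trancl[of ?E n a b L] r_into_trancl_subset[of ?E] by blast
  then show ?thesis
    unfolding eq[OF wmeet_perm(1)[OF assms]] eq[OF assms(1)] eq[OF assms(2)] wmeet_perm(2)[OF assms]
    by blast
qed

lemma lattice_cong_arc_cong: "lattice_cong n (arc_cong C n)"
  unfolding lattice_cong_def
proof (intro conjI allI impI)
  show "equiv (perm n) (arc_cong C n)" by (rule equiv_arc_cong)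
next
  fix x y z assume h: "(x, y) \<in> arc_cong C n \<and> z \<in> perm n"
  then have p: "x \<in> perm n" "y \<in> perm n" "z \<in> perm n" by (auto simp: arc_cong_def)
  show "(wjoin n x z, wjoin n y z) \<in> arc_cong C n"
    using h p by (simp add: arc_cong_dual wjoin_perm(1) arc_set_disjoint_wjoin)
  show "(wmeet n x z, wmeet n y z) \<in> arc_cong C n"
    using h p by (simp add: arc_cong_def wmeet_perm(1) arc_set_subset_wmeet)
qed

section \<open>Standardization\<close>

text \<open>Replaces the indexing in \<open>phiQ\<close> by any given increasing enumeration of
  \<open>Q\<close>. The shift \<open>a - 1\<close> passes from values counted from 1 to list
  positions counted from 0.\<close>

lemma sorted_list_of_set_nth:
  assumes "strict_mono_on {1..p} f" "f ` {1..p} = Q" "a \<in> {1..p}"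
  shows "sorted_list_of_set Q ! (a - 1) = f a"
proof -
  have "sorted_wrt (<) (map f [1..<Suc p])"
    unfolding sorted_wrt_map
  proof (rule sorted_wrt_mono_rel)
    show "sorted_wrt (<) [1..<Suc p]" by (rule sorted_wrt_upt)
  qed (use assms(1) in \<open>auto simp: strict_mono_on_def\<close>)
  then have "sorted_list_of_set (set (map f [1..<Suc p])) = map f [1..<Suc p]"
    by (intro sorted_list_of_set.idem_if_sorted_distinct)
      (auto simp: strict_sorted_iff)
  moreover have "set (map f [1..<Suc p]) = Q"
    using assms(2) by (simp del: upt_Suc add: atLeastLessThanSuc_atLeastAtMost)
  ultimately have "sorted_list_of_set Q = map f [1..<Suc p]" by simp
  then show ?thesis using assms(3) by (auto simp del: upt_Suc)
qed

lemma ex_strict_mono_enum: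
  assumes "finite (Q :: nat set)"
  obtains f :: "nat \<Rightarrow> nat" where "strict_mono_on {1..card Q} f" "f ` {1..card Q} = Q"
proof
  let ?f = "\<lambda>a. sorted_list_of_set Q ! (a - 1)"
  have len: "length (sorted_list_of_set Q) = card Q" by simp
  show "strict_mono_on {1..card Q} ?f"
  proof (rule strict_mono_onI)
    fix r s assume "r \<in> {1..card Q}" "s \<in> {1..card Q}" "r < s"
    then show "?f r < ?f s"
      using strict_sorted_list_of_set[of Q] by (simp add: sorted_wrt_iff_nth_less)
  qed
  have "?f ` {1..card Q} = (!) (sorted_list_of_set Q) ` {..<card Q}"
    by (force simp: image_iff Bex_def intro: exI[of _ "Suc _"])
  then show "?f ` {1..card Q} = Q"
    using nth_image[of "card Q" "sorted_list_of_set Q"] assms by (simp add: lessThan_atLeast0)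
qed

lemma phiQ_eq:
  assumes "u \<in> perm p" "v \<in> perm q" "strict_mono_on {1..p} f" "strict_mono_on {1..q} g"
    "f ` {1..p} = Q" "g ` {1..q} = {1..p + q} - Q"
  shows "phiQ Q u v = map f u @ map g v"
  using permD[OF assms(1)] permD[OF assms(2)] sorted_list_of_set_nth[OF assms(3,5)]
    sorted_list_of_set_nth[OF assms(4,6)]
  unfolding phiQ_def by (auto intro!: map_cong)

lemma map_append_in_perm:
  assumes "u \<in> perm p" "v \<in> perm q" "inj_on f {1..p}" "inj_on g {1..q}"
    "f ` {1..p} \<union> g ` {1..q} = {1..n}" "f ` {1..p} \<inter> g ` {1..q} = {}"
  shows "map f u @ map g v \<in> perm n"
  using permD[OF assms(1)] permD[OF assms(2)] assms(3-6)
  by (intro permI) (auto simp: distinct_map)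

lemma before_map_iff_ex:
  "before (map f xs) s t \<longleftrightarrow> (\<exists>s' t'. s = f s' \<and> t = f t' \<and> before xs s' t')"
  by (induction xs) auto

section \<open>Translational and insertional\<close>

lemma arc_cong_block:
  assumes uu: "(u, u') \<in> arc_cong C p" and f: "strict_mono_on {1..p} f" and av: "avoiding C a b L"
    and cd: "(f c, f d) \<in> arc_set a b (- L)" "c \<in> {1..p}" "d \<in> {1..p}"
    and u: "\<And>c d. c \<in> {1..p} \<Longrightarrow> d \<in> {1..p} \<Longrightarrow> (f c, f d) \<in> arc_set a b (- L) \<Longrightarrow> before u d c"
  shows "before u' d c"
proof -
  have f': "strict_mono_on {c..d} f"
    using f cd(2,3) by (auto simp: strict_mono_on_def)
  have mono: "f r \<le> f s" if "r \<in> {1..p}" "s \<in> {1..p}" "r \<le> s" for r s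
    using strict_mono_onD[OF f that(1,2)] that(3) by (cases "r = s") auto
  have fcd: "a \<le> f c" "f c < f d" "f d \<le> b" "f c \<notin> L \<or> f c = a" "f d \<in> L \<or> f d = b"
    using cd(1) by (auto simp: arc_set_def)
  have "c < d" using mono[OF cd(3,2)] fcd(2) by linarith
  have "avoiding C c d (f -` L)"
    using av embeds_image[OF _ f'] embeds_mono fcd(1,3) unfolding avoiding_def by blast
  moreover have "arc_set c d (- (f -` L)) \<subseteq> invs u"
  proof clarify
    fix r s assume "(r, s) \<in> arc_set c d (- (f -` L))"
    then have rs: "c \<le> r" "r < s" "s \<le> d" "f r \<notin> L \<or> r = c" "f s \<in> L \<or> s = d"
      by (auto simp: arc_set_def)
    then have in_p: "r \<in> {1..p}" "s \<in> {1..p}" using cd(2,3) by auto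
    have "f c \<le> f r" "f r < f s" "f s \<le> f d"
      using mono in_p cd(2,3) rs strict_mono_onD[OF f in_p] by auto
    then have "(f r, f s) \<in> arc_set a b (- L)"
      using rs fcd by (auto simp: arc_set_def)
    then show "(r, s) \<in> invs u" using u in_p rs(2) by (simp add: invs_iff)
  qed
  ultimately have "arc_set c d (- (f -` L)) \<subseteq> invs u'"
    using uu unfolding arc_cong_def by blast
  moreover have "(c, d) \<in> arc_set c d (- (f -` L))" using \<open>c < d\<close> by (simp add: arc_set_def)
  ultimately show ?thesis by (auto simp: invs_iff)
qed

lemma insertional_arc_cong: "insertional (arc_cong C)"
  unfolding insertional_def
proof (intro allI impI)
  fix p q Q u u' v v'
  assume h: "Q \<subseteq> {1..p + q} \<and> card Q = p \<and> u \<in> perm p \<and> u' \<in> perm p \<and> v \<in> perm q \<and> v' \<in> perm q \<and>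
      (u, u') \<in> arc_cong C p \<and> (v, v') \<in> arc_cong C q"
  then have fin: "finite Q" by (meson finite_atLeastAtMost finite_subset)
  obtain f :: "nat \<Rightarrow> nat" where f: "strict_mono_on {1..p} f" "f ` {1..p} = Q"
    using ex_strict_mono_enum[OF fin] h by metis
  let ?R = "{1..p + q} - Q"
  have "card ?R = q" using h fin by (simp add: card_Diff_subset)
  then obtain g :: "nat \<Rightarrow> nat" where g: "strict_mono_on {1..q} g" "g ` {1..q} = ?R"
    using ex_strict_mono_enum[of ?R] by auto
  have eq: "phiQ Q w w' = map f w @ map g w'" if "w \<in> perm p" "w' \<in> perm q" for w w'
    by (rule phiQ_eq[OF that f(1) g(1) f(2) g(2)])
  have inj: "inj_on f {1..p}" "inj_on g {1..q}"
    using f(1) g(1) strict_mono_on_imp_inj_on by blast+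
  have in_perm: "map f w @ map g w' \<in> perm (p + q)" if "w \<in> perm p" "w' \<in> perm q" for w w'
    by (rule map_append_in_perm[OF that inj]; unfold f(2) g(2); use h in blast)
  have half: "arc_set a b (- L) \<subseteq> invs (map f w' @ map g z')"
    if w: "(w, w') \<in> arc_cong C p" and z: "(z, z') \<in> arc_cong C q" and av: "avoiding C a b L"
      and sub: "arc_set a b (- L) \<subseteq> invs (map f w @ map g z)" for w w' z z' a b L
  proof clarify
    fix c d assume cd: "(c, d) \<in> arc_set a b (- L)"
    have sets: "set w = {1..p}" "set w' = {1..p}" "set z = {1..q}" "set z' = {1..q}"
      using w z permD(3) by (auto simp: arc_cong_def)
    have bef: "before (map f w @ map g z) s r" if "(r, s) \<in> arc_set a b (- L)" for r s
      using sub that by (auto simp: invs_iff)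
    have bw: "before w s r" if "r \<in> {1..p}" "s \<in> {1..p}" "(f r, f s) \<in> arc_set a b (- L)" for r s
    proof -
      have "f r \<in> Q" "f s \<in> Q" using that f(2) by auto
      then have "f r \<notin> set (map g z)" "f s \<notin> set (map g z)" using g(2) sets by auto
      then have "before (map f w) (f s) (f r)"
        using bef[OF that(3)] before_in_set[of "map g z" "f s" "f r"] unfolding before_append by blast
      then show ?thesis using before_map[OF inj(1), of w s r] sets that by simp
    qed
    have bz: "before z s r" if "r \<in> {1..q}" "s \<in> {1..q}" "(g r, g s) \<in> arc_set a b (- L)" for r s
    proof -
      have "g r \<notin> Q" "g s \<notin> Q" using that g(2) by auto
      then have "g r \<notin> set (map f w)" "g s \<notin> set (map f w)" using f(2) sets by auto
      then have "before (map g z) (g s) (g r)"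
        using bef[OF that(3)] before_in_set[of "map f w" "g s" "g r"] unfolding before_append by blast
      then show ?thesis using before_map[OF inj(2), of z s r] sets that by simp
    qed
    have "c < d" using cd by (simp add: arc_set_def)
    \<comment> \<open>Pairs inside a block are covered by \<open>arc_cong_block\<close>. A pair with
      d in the left block and c in the right one keeps its order, since \<open>Q\<close> alone
      decides it.\<close>
    moreover have "before (map f w' @ map g z') d c"
      using bef[OF cd] unfolding before_append
    proof (elim disjE)
      assume "before (map f w) d c"
      then obtain c' d' where cd': "c = f c'" "d = f d'" "before w d' c'"
        by (auto simp: before_map_iff_ex)
      then have mem: "c' \<in> {1..p}" "d' \<in> {1..p}" using before_in_set sets by metis+
      have "before w' d' c'"
        by (rule arc_cong_block[OF w f(1) av _ mem]) (use cd cd' bw in auto)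
      then show "before (map f w') d c \<or> before (map g z') d c \<or> d \<in> set (map f w') \<and> c \<in> set (map g z')"
        using cd' by (auto simp: before_map_iff_ex)
    next
      assume "before (map g z) d c"
      then obtain c' d' where cd': "c = g c'" "d = g d'" "before z d' c'"
        by (auto simp: before_map_iff_ex)
      then have mem: "c' \<in> {1..q}" "d' \<in> {1..q}" using before_in_set sets by metis+
      have "before z' d' c'"
        by (rule arc_cong_block[OF z g(1) av _ mem]) (use cd cd' bz in auto)
      then show "before (map f w') d c \<or> before (map g z') d c \<or> d \<in> set (map f w') \<and> c \<in> set (map g z')"
        using cd' by (auto simp: before_map_iff_ex)
    qed (use sets in simp)
    ultimately show "(c, d) \<in> invs (map f w' @ map g z')" by (simp add: invs_iff)
  qed
  have sym: "(u', u) \<in> arc_cong C p" "(v', v) \<in> arc_cong C q"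
    using h by (auto simp: arc_cong_def)
  have "(map f u @ map g v, map f u' @ map g v') \<in> arc_cong C (p + q)"
    unfolding arc_cong_def[of C "p + q"]
    using in_perm half[of u u' v v'] half[OF sym] h by blast
  then show "(phiQ Q u v, phiQ Q u' v') \<in> arc_cong C (p + q)"
    using h eq by simp
qed

text \<open>Shifting all values by k turns an arc of the small permutation into an arc of the large
  one with the same word, so avoidance is unaffected. This cancels either factor of a
  product.\<close>

lemma arc_cong_shift:
  assumes xy: "(x, y) \<in> arc_cong C n" and perm: "u \<in> perm p" "v \<in> perm p"
    and u: "\<And>c d. c \<in> {1..p} \<Longrightarrow> d \<in> {1..p} \<Longrightarrow> (k + c, k + d) \<in> invs x \<longleftrightarrow> (c, d) \<in> invs u"
    and v: "\<And>c d. c \<in> {1..p} \<Longrightarrow> d \<in> {1..p} \<Longrightarrow> (k + c, k + d) \<in> invs y \<longleftrightarrow> (c, d) \<in> invs v"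
  shows "(u, v) \<in> arc_cong C p"
proof -
  have half: "arc_set a b (- L) \<subseteq> invs v"
    if xy: "(x, y) \<in> arc_cong C n" and u_perm: "u \<in> perm p" and av: "avoiding C a b L"
      and sub: "arc_set a b (- L) \<subseteq> invs u"
      and u: "\<And>c d. c \<in> {1..p} \<Longrightarrow> d \<in> {1..p} \<Longrightarrow> (k + c, k + d) \<in> invs x \<longleftrightarrow> (c, d) \<in> invs u"
      and v: "\<And>c d. c \<in> {1..p} \<Longrightarrow> d \<in> {1..p} \<Longrightarrow> (k + c, k + d) \<in> invs y \<longleftrightarrow> (c, d) \<in> invs v"
    for x y u v a b L
  proof (cases "a < b")
    case False
    then show ?thesis by (auto simp: arc_set_def)
  next
    case True
    then have "(a, b) \<in> arc_set a b (- L)" by (simp add: arc_set_def)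
    then have "(a, b) \<in> pairs p"
      using sub biclosed_subset[OF biclosed_invs[OF u_perm]] by blast
    then have ab: "1 \<le> a" "b \<le> p" by (auto simp: pairs_def)
    \<comment> \<open>Only values from k + a to k + b matter, and there the truncated subtraction is
      exact and increasing.\<close>
    let ?L = "(\<lambda>c. c - k) -` L"
    have "strict_mono_on {k + a..k + b} (\<lambda>c. c - k)"
      by (auto simp: strict_mono_on_def)
    then have "embeds \<gamma> a b L" if "embeds \<gamma> (k + a) (k + b) ?L" for \<gamma>
      using embeds_image[OF that] by simp
    then have "avoiding C (k + a) (k + b) ?L"
      using av unfolding avoiding_def by blast
    moreover have "arc_set (k + a) (k + b) (- ?L) \<subseteq> invs x"
    proof clarify
      fix r s assume rs: "(r, s) \<in> arc_set (k + a) (k + b) (- ?L)"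
      then have "k + a \<le> r" "r < s" "s \<le> k + b" by (auto simp: arc_set_def)
      then obtain c d where cd: "r = k + c" "s = k + d" "a \<le> c" "c < d" "d \<le> b"
        using le_iff_add[of "k + a" r] le_iff_add[of "k + a" s] by (auto simp: add.assoc)
      then have "(c, d) \<in> arc_set a b (- L)" using rs by (auto simp: arc_set_def)
      then show "(r, s) \<in> invs x" using sub u[of c d] cd ab by auto
    qed
    ultimately have sub_y: "arc_set (k + a) (k + b) (- ?L) \<subseteq> invs y"
      using xy unfolding arc_cong_def by blast
    show ?thesis
    proof clarify
      fix c d assume cd: "(c, d) \<in> arc_set a b (- L)"
      then have "(k + c, k + d) \<in> arc_set (k + a) (k + b) (- ?L)" by (auto simp: arc_set_def)
      with sub_y have "(k + c, k + d) \<in> invs y" by (rule subsetD)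
      then show "(c, d) \<in> invs v" using v[of c d] cd ab by (auto simp: arc_set_def)
    qed
  qed
  have yx: "(y, x) \<in> arc_cong C n" using xy by (auto simp: arc_cong_def)
  show ?thesis
    unfolding arc_cong_def using perm half[OF xy perm(1) _ _ u v] half[OF yx perm(2) _ _ v u] by blast
qed

lemma invs_ptimes_left:
  assumes "u \<in> perm p" "v \<in> perm q" "c \<in> {1..p}" "d \<in> {1..p}"
  shows "(c, d) \<in> invs (ptimes u v) \<longleftrightarrow> (c, d) \<in> invs u"
  using permD[OF assms(1)] permD[OF assms(2)] assms(3,4)
  unfolding invs_iff ptimes_def before_append
  by (auto dest: before_in_set)

lemma invs_ptimes_right:
  assumes "u \<in> perm p" "v \<in> perm q" "c \<in> {1..q}" "d \<in> {1..q}"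
  shows "(p + c, p + d) \<in> invs (ptimes u v) \<longleftrightarrow> (c, d) \<in> invs v"
  using permD[OF assms(1)] permD[OF assms(2)] assms(3,4) before_map[of "(+) p" UNIV v d c]
  unfolding invs_iff ptimes_def before_append
  by (auto dest: before_in_set)

lemma translational_arc_cong: "translational (arc_cong C)"
  unfolding translational_def
proof (intro allI impI)
  fix p q u u' v v'
  assume h: "u \<in> perm p \<and> u' \<in> perm p \<and> v \<in> perm q \<and> v' \<in> perm q"
  show "(ptimes u v, ptimes u' v') \<in> arc_cong C (p + q) \<longleftrightarrow>
    (u, u') \<in> arc_cong C p \<and> (v, v') \<in> arc_cong C q"
  proof
    assume uv: "(ptimes u v, ptimes u' v') \<in> arc_cong C (p + q)"
    have "(u, u') \<in> arc_cong C p"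
      by (rule arc_cong_shift[OF uv, of _ _ _ 0]) (use h invs_ptimes_left in auto)
    moreover have "(v, v') \<in> arc_cong C q"
      by (rule arc_cong_shift[OF uv, of _ _ _ p]) (use h invs_ptimes_right in auto)
    ultimately show "(u, u') \<in> arc_cong C p \<and> (v, v') \<in> arc_cong C q" ..
  next
    assume uv: "(u, u') \<in> arc_cong C p \<and> (v, v') \<in> arc_cong C q"
    \<comment> \<open>The product is the insertion with \<open>Q = {1..p}\<close>, so this
      implication is a special case of insertionality.\<close>
    have im: "(+) p ` {1..q} = {1..p + q} - {1..p}"
      by (auto simp: image_iff)
    have eq: "ptimes w w' = phiQ {1..p} w w'" if "w \<in> perm p" "w' \<in> perm q" for w w'
    proof -
      have "phiQ {1..p} w w' = map (\<lambda>a. a) w @ map ((+) p) w'"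
        by (rule phiQ_eq[OF that _ _ _ im]) (auto simp: strict_mono_on_def)
      then show ?thesis using permD(1)[OF that(1)] by (simp add: ptimes_def)
    qed
    have "(phiQ {1..p} u v, phiQ {1..p} u' v') \<in> arc_cong C (p + q)"
      using insertional_arc_cong[of C] h uv unfolding insertional_def
      by (metis Diff_subset add_diff_cancel_left' card_atLeastAtMost atLeastatMost_subset_iff
          diff_Suc_1 le_add1 order_refl plus_1_eq_Suc)
    then show "(ptimes u v, ptimes u' v') \<in> arc_cong C (p + q)" using h eq by simp
  qed
qed

lemma H_family_arc_cong: "H_family (arc_cong C)"
  unfolding H_family_def
  using lattice_cong_arc_cong translational_arc_cong insertional_arc_cong by blast

section \<open>Descents and covers\<close>

lemma invs_swap:
  assumes "distinct (X @ b # a # Y)" "a < b"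
  shows "invs (X @ b # a # Y) = insert (a, b) (invs (X @ a # b # Y))"
    "(a, b) \<notin> invs (X @ a # b # Y)"
proof -
  have "(c, d) \<in> invs (X @ b # a # Y) \<longleftrightarrow> (c, d) \<in> insert (a, b) (invs (X @ a # b # Y))" for c d
    using assms by (auto simp: invs_iff before_append)
  then show "invs (X @ b # a # Y) = insert (a, b) (invs (X @ a # b # Y))" by auto
  show "(a, b) \<notin> invs (X @ a # b # Y)"
    using assms by (auto simp: invs_iff before_append dest: before_in_set)
qed

lemma swap_in_perm: "X @ b # a # Y \<in> perm n \<Longrightarrow> X @ a # b # Y \<in> perm n"
  by (auto simp: perm_def insert_commute)

lemma covered_by_swap:
  assumes "X @ b # a # Y \<in> perm n" "a < b"
  shows "covered_by n (X @ a # b # Y) (X @ b # a # Y)"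
proof -
  let ?x = "X @ b # a # Y" and ?y = "X @ a # b # Y"
  note sw = invs_swap[OF permD(2)[OF assms(1)] assms(2)] and py = swap_in_perm[OF assms(1)]
  have False if z: "z \<in> perm n" "wlt ?y z" "wlt z ?x" for z
  proof -
    have "invs ?y \<subseteq> invs z" "invs z \<subseteq> insert (a, b) (invs ?y)"
      using z(2,3) sw(1) unfolding wlt_def wle_def by auto
    then have "invs z = invs ?y \<or> invs z = invs ?x"
      unfolding sw(1) by (cases "(a, b) \<in> invs z") auto
    then show False
      using invs_inject[OF z(1) py] invs_inject[OF z(1) assms(1)] z(2,3) unfolding wlt_def by blast
  qed
  then show ?thesis
    using assms py sw unfolding covered_by_def wlt_def wle_def by blast
qed

text \<open>Otherwise \<open>y\<close> would invert every inversion of \<open>x\<close>, by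
  induction on the distance of the two positions. The entry e just after the left one decides: if
  its value lies between the two, transitivity applies; if not, e is in natural order with one of
  them in \<open>x\<close>, hence in \<open>y\<close>, and cotransitivity applies. This locates the
  descent undone by an unspecified lower element.\<close>

lemma ex_descent_not_inv:
  assumes x: "x \<in> perm n" and y: "y \<in> perm n" and "wlt y x"
  obtains X b a Y where "x = X @ b # a # Y" "a < b" "(a, b) \<notin> invs y"
proof (rule ccontr)
  note thesisI = that
  assume nt: "\<not> thesis"
  have desc: "(a, b) \<in> invs y" if "x = X @ b # a # Y" "a < b" for X b a Y
    using thesisI[OF that] nt by blast
  have yx: "invs y \<subseteq> invs x" using \<open>wlt y x\<close> by (simp add: wlt_def wle_def)
  note co = biclosed_cotrans[OF biclosed_invs[OF y]] and tr = biclosed_trans[OF biclosed_invs[OF y]]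
  have inv_nth: "x ! i < x ! j \<Longrightarrow> (x ! i, x ! j) \<in> invs x \<longleftrightarrow> j < i"
    if "i < length x" "j < length x" for i j
    using that permD(2)[OF x] by (auto simp: invs_def nth_eq_iff_index_eq)
  have "(x ! j, x ! i) \<in> invs y" if "i < j" "j < length x" "x ! j < x ! i" for i j
    using that
  proof (induction "j - i" arbitrary: i j rule: less_induct)
    case less
    show ?case
    proof (cases "j = Suc i")
      case True
      then have "x = take i x @ x ! i # x ! j # drop (Suc j) x"
        using less.prems by (simp add: Cons_nth_drop_Suc)
      then show ?thesis using desc less.prems(3) by blast
    next
      case False
      let ?e = "x ! Suc i"
      have lt: "i < Suc i" "Suc i < j" "i < length x" "Suc i < length x"
        using False less.prems by auto
      have "?e \<noteq> x ! i" "?e \<noteq> x ! j"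
        using permD(2)[OF x] lt less.prems(2) by (auto simp: nth_eq_iff_index_eq)
      then consider "x ! j < ?e" "?e < x ! i" | "x ! i < ?e" | "?e < x ! j"
        using less.prems(3) by linarith
      then show ?thesis
      proof cases
        case 1
        then have "(x ! j, ?e) \<in> invs y" "(?e, x ! i) \<in> invs y"
          using less.hyps[of j "Suc i"] less.hyps[of "Suc i" i] lt less.prems by auto
        then show ?thesis by (rule tr)
      next
        case 2
        then have "(x ! j, ?e) \<in> invs y"
          using less.hyps[of j "Suc i"] lt less.prems by auto
        moreover have "(x ! i, ?e) \<notin> invs y"
          using inv_nth[of i "Suc i"] yx lt 2 by auto
        ultimately show ?thesis using co[of "x ! j" ?e "x ! i"] less.prems(3) 2 by blast
      next
        case 3
        then have "(?e, x ! i) \<in> invs y"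
          using less.hyps[of "Suc i" i] lt less.prems by auto
        moreover have "(?e, x ! j) \<notin> invs y"
          using inv_nth[of "Suc i" j] yx lt 3 less.prems(2) by auto
        ultimately show ?thesis using co[of ?e "x ! i" "x ! j"] less.prems(3) 3 by blast
      qed
    qed
  qed
  then have "invs x \<subseteq> invs y" unfolding invs_def[of x] by auto
  then have "x = y" using invs_inject[OF x y] yx by blast
  then show False using \<open>wlt y x\<close> by (simp add: wlt_def)
qed

text \<open>In such a pair the larger value stands at b or to its left, the smaller at a or to its
  right, so the descent separates them. Thus the join-irreducible of the arc of a descent lies below
  the permutation.\<close>

lemma arc_set_subset_invs:
  assumes "X @ b # a # Y \<in> perm n" "a < b"
  shows "arc_set a b (- set X) \<subseteq> invs (X @ b # a # Y)"
proof clarify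
  fix c d assume "(c, d) \<in> arc_set a b (- set X)"
  then have cd: "a \<le> c" "c < d" "d \<le> b" "c \<notin> set X \<or> c = a" "d \<in> set X \<or> d = b"
    by (auto simp: arc_set_def)
  note x = permD[OF assms(1)]
  have "a \<in> {1..n}" "b \<in> {1..n}" unfolding x(3)[symmetric] by auto
  then have "c \<in> set (X @ b # a # Y)" "d \<in> set (X @ b # a # Y)" unfolding x(3) using cd by auto
  then show "(c, d) \<in> invs (X @ b # a # Y)"
    using cd x(2) by (auto simp: invs_iff before_append)
qed

text \<open>The largest value is not last and so starts a descent; the value 1 is not first and so
  ends one. With a single descent the two coincide.\<close>

lemma untranslated_ji_form:
  assumes "\<gamma> \<in> perm k" "join_irreducible \<gamma>" "untranslated \<gamma>"
  obtains G H where "\<gamma> = G @ k # 1 # H" "descents \<gamma> = {length G}" "left_values \<gamma> = set G" "1 < k"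
proof -
  note g = permD[OF assms(1)]
  obtain i where i: "descents \<gamma> = {i}" using assms(2) by (auto simp: join_irreducible_def card_1_singleton_iff)
  have ne: "\<gamma> \<noteq> []" "\<gamma> ! 0 > 1" "\<gamma> ! (k - 1) < k"
    using assms(3) g(1) by (auto simp: untranslated_def hd_conv_nth last_conv_nth)
  then have "k \<ge> 1" using g(1) by (cases \<gamma>) auto
  then have "k \<in> set \<gamma>" "1 \<in> set \<gamma>" using g(3) by auto
  then obtain s t where s: "s < k" "\<gamma> ! s = k" and t: "t < k" "\<gamma> ! t = 1"
    using g(1) by (auto simp: in_set_conv_nth)
  have in_range: "\<gamma> ! r \<in> {1..k}" if "r < k" for r
    using g that nth_mem by metis
  have neq: "\<gamma> ! r \<noteq> \<gamma> ! r'" if "r < k" "r' < k" "r \<noteq> r'" for r r'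
    using g that by (simp add: nth_eq_iff_index_eq)
  have "s \<noteq> k - 1" using s(2) ne(3) by auto
  then have s': "Suc s < k" using s(1) by linarith
  then have "\<gamma> ! Suc s < k" using in_range[OF s'] neq[OF s', of s] s by auto
  then have "s \<in> descents \<gamma>" using s s' g(1) by (simp add: descents_def)
  then have "s = i" using i by simp
  have "t \<noteq> 0" using t(2) ne(2) by (metis less_irrefl)
  then obtain t' where t': "t = Suc t'" by (cases t) auto
  then have "\<gamma> ! t' > 1" using in_range[of t'] neq[of t' t] t by force
  then have "t' \<in> descents \<gamma>" using t t' g(1) by (simp add: descents_def)
  then have "t' = i" using i by simp
  let ?G = "take i \<gamma>" and ?H = "drop (Suc (Suc i)) \<gamma>"
  have "\<gamma> = ?G @ \<gamma> ! i # \<gamma> ! Suc i # ?H"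
    using s' g(1) \<open>s = i\<close> by (simp add: Cons_nth_drop_Suc)
  then have eq: "\<gamma> = ?G @ k # 1 # ?H" using s(2) t(2) t' \<open>s = i\<close> \<open>t' = i\<close> by simp
  then have "k \<notin> set ?G" using g(2) by (metis disjoint_iff distinct_append list.set_intros(1))
  then have "takeWhile (\<lambda>v. v \<noteq> k) (?G @ k # 1 # ?H) = ?G"
    by (subst takeWhile_append2) auto
  then have "left_values \<gamma> = set ?G" unfolding left_values_def g(1) using eq by simp
  moreover have "descents \<gamma> = {length ?G}" using i s(1) g(1) \<open>s = i\<close> by simp
  ultimately show thesis using that[OF eq] s' by linarith
qed

text \<open>Swapping the descent removes only the inversion (1, k). An arc set below \<gamma> that
  contains it must run from 1 to k, and lying below \<gamma> fixes the letter of every intermediate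
  value to that in \<gamma>. The identity then embeds \<gamma>, so no avoiding arc separates the two
  permutations.\<close>

lemma contracts_arc_cong:
  assumes "\<gamma> \<in> C" "\<gamma> \<in> perm k" "join_irreducible \<gamma>" "untranslated \<gamma>"
  shows "contracts k (arc_cong C k) \<gamma>"
proof -
  obtain G H where g: "\<gamma> = G @ k # 1 # H" "left_values \<gamma> = set G" "1 < k"
    using untranslated_ji_form[OF assms(2-4)] by metis
  let ?g = "G @ 1 # k # H"
  have perm: "?g \<in> perm k" using swap_in_perm assms(2) g(1) by blast
  have sw: "invs \<gamma> = insert (1, k) (invs ?g)"
    using invs_swap[of G k 1 H] permD(2)[OF assms(2)] g by blast
  have "arc_set a b (- L) \<subseteq> invs ?g"
    if av: "avoiding C a b L" and sub: "arc_set a b (- L) \<subseteq> invs \<gamma>" for a b L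
  proof (rule ccontr)
    assume "\<not> arc_set a b (- L) \<subseteq> invs ?g"
    then obtain e where "e \<in> arc_set a b (- L)" "e \<notin> invs ?g" by blast
    then have in_arc: "(1, k) \<in> arc_set a b (- L)" using sub unfolding sw by auto
    then have "(a, b) \<in> arc_set a b (- L)" by (auto simp: arc_set_def)
    then have "(a, b) \<in> pairs k"
      using sub biclosed_subset[OF biclosed_invs[OF assms(2)]] by blast
    then have ab: "a = 1" "b = k" using in_arc by (auto simp: arc_set_def pairs_def)
    have bef: "before \<gamma> s r" if "(r, s) \<in> arc_set 1 k (- L)" for r s
      using sub that ab by (auto simp: invs_iff)
    have "v \<in> L \<longleftrightarrow> v \<in> set G" if v: "v \<in> {1<..<k}" for v
    proof
      assume "v \<in> L"
      then have "(1, v) \<in> arc_set 1 k (- L)" using v by (auto simp: arc_set_def)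
      then show "v \<in> set G"
        using bef v permD(2)[OF assms(2)]
        by (auto simp: g(1) before_append dest: before_in_set)
    next
      assume "v \<in> set G"
      show "v \<in> L"
      proof (rule ccontr)
        assume "v \<notin> L"
        then have "(v, k) \<in> arc_set 1 k (- L)" using v by (auto simp: arc_set_def)
        then show False
          using bef v permD(2)[OF assms(2)] \<open>v \<in> set G\<close>
          by (auto simp: g(1) before_append dest: before_in_set)
      qed
    qed
    then have "embeds \<gamma> a b L"
      unfolding embeds_def ab g(2) permD(1)[OF assms(2)]
      by (intro exI[of _ "\<lambda>v. v"]) (auto simp: strict_mono_on_def)
    then show False using av assms(1) unfolding avoiding_def by blast
  qed
  then have "(\<gamma>, ?g) \<in> arc_cong C k"
    using perm assms(2) sw unfolding arc_cong_def by blast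
  moreover have "covered_by k ?g \<gamma>"
    using covered_by_swap assms(2) g by blast
  ultimately show ?thesis unfolding contracts_def by blast
qed

definition arc_occurs :: "nat list \<Rightarrow> nat list \<Rightarrow> bool" where
  "arc_occurs \<gamma> x \<longleftrightarrow> (\<exists>X b a Y. x = X @ b # a # Y \<and> a < b \<and> embeds \<gamma> a b (set X))"

text \<open>\<open>arc_cong C\<close> is one of the families intersected in \<open>HC C\<close>. The
  arc of the descent undone by \<open>y\<close> has its join-irreducible below \<open>x\<close> but
  not below \<open>y\<close>, so it cannot be avoiding.\<close>

lemma contracts_imp_arc_occurs:
  assumes C: "\<forall>\<gamma> \<in> C. (\<exists>k. \<gamma> \<in> perm k) \<and> join_irreducible \<gamma> \<and> untranslated \<gamma>"
    and "contracts n (HC C n) x"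
  shows "\<exists>\<gamma> \<in> C. arc_occurs \<gamma> x"
proof -
  obtain y where y: "covered_by n y x" "(x, y) \<in> HC C n"
    using assms(2) by (auto simp: contracts_def)
  have "contracts_all (arc_cong C) C"
    unfolding contracts_all_def using C contracts_arc_cong permD(1) by metis
  then have xy: "(x, y) \<in> arc_cong C n"
    using y(2) H_family_arc_cong unfolding HC_def by blast
  have perm: "x \<in> perm n" "y \<in> perm n" and "wlt y x"
    using y(1) by (auto simp: covered_by_def)
  then obtain X b a Y where x: "x = X @ b # a # Y" "a < b" "(a, b) \<notin> invs y"
    by (rule ex_descent_not_inv)
  have "\<not> avoiding C a b (set X)"
  proof
    assume "avoiding C a b (set X)"
    then have "arc_set a b (- set X) \<subseteq> invs y"
      using xy arc_set_subset_invs[of X b a Y n] x perm(1) unfolding arc_cong_def by blast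
    moreover have "(a, b) \<in> arc_set a b (- set X)" using x(2) by (simp add: arc_set_def)
    ultimately show False using x(3) by blast
  qed
  then show ?thesis unfolding avoiding_def arc_occurs_def using x by blast
qed

section \<open>Forced contractions\<close>

text \<open>
  Whether a swap of adjacent entries is contracted depends only on the sets of values to its left and
  to its right: meeting with, and then joining up from, the permutation with both sides sorted
  transports the contraction.
\<close>

lemma lattice_cong_same_sides:
  assumes cong: "lattice_cong n \<Theta>" and "a < b"
    and x: "X @ b # a # Y \<in> perm n" and x': "X' @ b # a # Y' \<in> perm n" and "set X' = set X"
    and rel: "(X' @ b # a # Y', X' @ a # b # Y') \<in> \<Theta>"
  shows "(X @ b # a # Y, X @ a # b # Y) \<in> \<Theta>"
proof -
  define Xs Ys where "Xs = sorted_list_of_set (set X)" and "Ys = sorted_list_of_set (set Y)"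
  have sets: "set Xs = set X" "set Ys = set Y" and dist: "distinct Xs" "distinct Ys"
    by (auto simp: Xs_def Ys_def)
  have sorted: "sorted_wrt (<) Xs" "sorted_wrt (<) Ys"
    by (auto simp: Xs_def Ys_def strict_sorted_list_of_set)
  let ?m = "Xs @ b # a # Ys" and ?m' = "Xs @ a # b # Ys"
  have m: "?m \<in> perm n"
    using permD[OF x] sets dist by (intro permI) auto
  have Y: "set Y' = set Y"
    using permD[OF x] permD[OF x'] \<open>set X' = set X\<close>
    by (auto 4 4 simp: set_eq_iff)
  note m' = swap_in_perm[OF m]
  note sw_m = invs_swap[OF permD(2)[OF m] \<open>a < b\<close>]
  have below: "invs ?m \<subseteq> invs (U @ b # a # V)" if "set U = set X" "set V = set Y" for U V
    using before_sorted_wrt[OF sorted(1)] before_sorted_wrt[OF sorted(2)] that sets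
    by (fastforce simp: invs_iff before_append)
  have below_iff: "invs w \<subseteq> invs ?m' \<longleftrightarrow> invs w \<subseteq> invs ?m \<and> (a, b) \<notin> invs w" for w
    unfolding sw_m(1) using sw_m(2) by blast
  have step: "wmeet n (X' @ b # a # Y') ?m = ?m" "wmeet n (X' @ a # b # Y') ?m = ?m'"
    "wjoin n ?m (X @ a # b # Y) = X @ b # a # Y" "wjoin n ?m' (X @ a # b # Y) = X @ a # b # Y"
  proof -
    note sw = invs_swap[OF permD(2)[OF x] \<open>a < b\<close>] and sw' = invs_swap[OF permD(2)[OF x'] \<open>a < b\<close>]
    have le: "invs ?m \<subseteq> invs (X @ b # a # Y)" "invs ?m \<subseteq> invs (X' @ b # a # Y')"
      using below \<open>set X' = set X\<close> Y by auto
    have le': "invs ?m' \<subseteq> invs (X @ a # b # Y)" "invs ?m' \<subseteq> invs (X' @ a # b # Y')"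
      using le sw_m(2) unfolding sw(1) sw'(1) sw_m(1) by blast+
    have ab: "(a, b) \<in> invs ?m" unfolding sw_m(1) by simp
    show "wmeet n (X' @ b # a # Y') ?m = ?m"
      by (rule wmeet_eqI[OF m]) (use le in \<open>auto simp: wle_def\<close>)
    show "wjoin n ?m' (X @ a # b # Y) = X @ a # b # Y"
      by (rule wjoin_eqI[OF swap_in_perm[OF x]]) (use le' in \<open>auto simp: wle_def\<close>)
    show "wmeet n (X' @ a # b # Y') ?m = ?m'"
    proof (rule wmeet_eqI[OF m'])
      fix w assume "wle w (X' @ a # b # Y')" "wle w ?m"
      then show "wle w ?m'" using sw'(2) unfolding wle_def below_iff by blast
    qed (use le' sw_m in \<open>auto simp: wle_def\<close>)
    show "wjoin n ?m (X @ a # b # Y) = X @ b # a # Y"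
    proof (rule wjoin_eqI[OF x])
      fix w assume "wle ?m w" "wle (X @ a # b # Y) w"
      then show "wle (X @ b # a # Y) w" using ab unfolding wle_def sw(1) by blast
    qed (use le sw in \<open>auto simp: wle_def\<close>)
  qed
  have "(?m, ?m') \<in> \<Theta>"
    using cong rel m unfolding lattice_cong_def by (metis step(1,2))
  then show ?thesis
    using cong swap_in_perm[OF x] unfolding lattice_cong_def by (metis step(3,4))
qed

section \<open>Insertion of entries around a congruent pair\<close>

lemma ex_perm_map:
  assumes "inj_on g {1..q}" "g ` {1..q} = set Y" "distinct Y"
  obtains v where "v \<in> perm q" "map g v = Y"
proof
  let ?h = "inv_into {1..q} g"
  have "g (?h y) = y" if "y \<in> set Y" for y
    using that f_inv_into_f[of y g "{1..q}"] unfolding assms(2) by blast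
  then show "map g (map ?h Y) = Y"
    unfolding map_map by (intro map_idI) simp
  have "inj_on ?h (set Y)" by (rule inj_on_inv_into) (simp only: assms(2) subset_refl)
  moreover have "?h ` set Y = {1..q}"
    unfolding assms(2)[symmetric] by (rule inv_into_image_cancel[OF assms(1) subset_refl])
  ultimately show "map ?h Y \<in> perm q"
    using assms(3) by (intro permI) (simp_all add: distinct_map)
qed

lemma card_append_perm:
  assumes "X @ Y \<in> perm n"
  shows "card (set X) = length X" "card (set Y) = length Y" "n = length X + length Y"
    "set Y = {1..n} - set X" "set X = {1..n} - set Y"
proof -
  note p = permD[OF assms]
  show "card (set X) = length X" "card (set Y) = length Y"
    using p(2) by (simp_all add: distinct_card)
  show "n = length X + length Y" using p(1) by simp
  show "set Y = {1..n} - set X" "set X = {1..n} - set Y"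
    unfolding p(3)[symmetric] using p(2) by auto
qed

lemma insertionalD:
  assumes "insertional \<Theta>" "Q \<subseteq> {1..p + q}" "card Q = p"
    "u \<in> perm p" "u' \<in> perm p" "v \<in> perm q" "v' \<in> perm q" "(u, u') \<in> \<Theta> p" "(v, v') \<in> \<Theta> q"
  shows "(phiQ Q u v, phiQ Q u' v') \<in> \<Theta> (p + q)"
  using assms(1)[unfolded insertional_def, rule_format, of Q p q u u' v v'] assms(2-) by simp

text \<open>Insertionality with a constant second block: \<open>Y\<close> is standardized to a
  permutation \<open>v\<close>, and reflexivity supplies the pair (v, v).\<close>

lemma insertional_right:
  assumes ins: "insertional \<Theta>" and eq: "\<And>n. equiv (perm n) (\<Theta> n)"
    and uu: "(u, u') \<in> \<Theta> p" and f: "strict_mono_on {1..p} f" and perm: "map f u @ Y \<in> perm n"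
  shows "(map f u @ Y, map f u' @ Y) \<in> \<Theta> n"
proof -
  have u: "u \<in> perm p" "u' \<in> perm p" using eq[of p] uu unfolding equiv_def by blast+
  let ?q = "length Y" and ?Q = "f ` {1..p}"
  note c = card_append_perm[OF perm]
  have Q: "set (map f u) = ?Q" using permD(3)[OF u(1)] by simp
  have n: "n = p + ?q" using c(3) permD(1)[OF u(1)] by simp
  obtain g :: "nat \<Rightarrow> nat" where g: "strict_mono_on {1..?q} g" "g ` {1..?q} = set Y"
    using ex_strict_mono_enum[of "set Y"] c(2) by auto
  have "distinct Y" using permD(2)[OF perm] by simp
  then obtain v where v: "v \<in> perm ?q" "map g v = Y"
    using ex_perm_map[OF strict_mono_on_imp_inj_on[OF g(1)] g(2)] by blast
  have g': "g ` {1..?q} = {1..p + ?q} - ?Q"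
    unfolding g(2) Q[symmetric] n[symmetric] by (rule c(4))
  have "(v, v) \<in> \<Theta> ?q" using eq[of ?q] v(1) unfolding equiv_def refl_on_def by blast
  moreover have "card ?Q = p"
    using c(1) permD(1)[OF u(1)] unfolding Q by simp
  moreover have "?Q \<subseteq> {1..p + ?q}"
    unfolding Q[symmetric] n[symmetric] c(5) by (rule Diff_subset)
  ultimately have "(phiQ ?Q u v, phiQ ?Q u' v) \<in> \<Theta> (p + ?q)"
    using u v(1) uu by (intro insertionalD[OF ins])
  then show ?thesis
    unfolding phiQ_eq[OF u(1) v(1) f g(1) refl g'] phiQ_eq[OF u(2) v(1) f g(1) refl g'] v(2)
      n[symmetric] .
qed

lemma insertional_left:
  assumes ins: "insertional \<Theta>" and eq: "\<And>n. equiv (perm n) (\<Theta> n)"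
    and vv: "(v, v') \<in> \<Theta> q" and g: "strict_mono_on {1..q} g" and perm: "X @ map g v \<in> perm n"
  shows "(X @ map g v, X @ map g v') \<in> \<Theta> n"
proof -
  have v: "v \<in> perm q" "v' \<in> perm q" using eq[of q] vv unfolding equiv_def by blast+
  let ?p = "length X" and ?Q = "set X"
  note c = card_append_perm[OF perm]
  have n: "n = ?p + q" using c(3) permD(1)[OF v(1)] by simp
  obtain f :: "nat \<Rightarrow> nat" where f: "strict_mono_on {1..?p} f" "f ` {1..?p} = ?Q"
    using ex_strict_mono_enum[of "set X"] c(1) by auto
  have "distinct X" using permD(2)[OF perm] by simp
  then obtain u where u: "u \<in> perm ?p" "map f u = X"
    using ex_perm_map[OF strict_mono_on_imp_inj_on[OF f(1)] f(2)] by blast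
  have "set (map g v) = g ` {1..q}" using permD(3)[OF v(1)] by simp
  then have g': "g ` {1..q} = {1..?p + q} - ?Q"
    using c(4) unfolding n[symmetric] by simp
  have "(u, u) \<in> \<Theta> ?p" using eq[of ?p] u(1) unfolding equiv_def refl_on_def by blast
  moreover have "?Q \<subseteq> {1..?p + q}"
    unfolding n[symmetric] c(5) by (rule Diff_subset)
  ultimately have "(phiQ ?Q u v, phiQ ?Q u v') \<in> \<Theta> (?p + q)"
    using v u(1) vv c(1) by (intro insertionalD[OF ins])
  then show ?thesis
    unfolding phiQ_eq[OF u(1) v(1) f(1) g f(2) g'] phiQ_eq[OF u(1) v(2) f(1) g f(2) g'] u(2)
      n[symmetric] .
qed

text \<open>Insertionality joins only two blocks, so a context on both sides takes two rounds:
  \<open>Y\<close> is attached within the standardized values of \<open>?Z\<close>, and the result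
  is then inserted to the right of \<open>X\<close>.\<close>

lemma insertional_both:
  assumes ins: "insertional \<Theta>" and eq: "\<And>n. equiv (perm n) (\<Theta> n)"
    and uu: "(u, u') \<in> \<Theta> p" and f: "strict_mono_on {1..p} f" and perm: "X @ map f u @ Y \<in> perm n"
  shows "(X @ map f u @ Y, X @ map f u' @ Y) \<in> \<Theta> n"
proof -
  have u: "u \<in> perm p" "u' \<in> perm p" using eq[of p] uu unfolding equiv_def by blast+
  let ?Z = "map f u @ Y"
  let ?r = "card (set ?Z)"
  obtain g :: "nat \<Rightarrow> nat" where g: "strict_mono_on {1..?r} g" "g ` {1..?r} = set ?Z"
    using ex_strict_mono_enum[of "set ?Z"] by auto
  let ?h = "inv_into {1..?r} g"
  have inj: "inj_on g {1..?r}" using g(1) strict_mono_on_imp_inj_on by blast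
  have gh: "g (?h z) = z" if "z \<in> set ?Z" for z
    using that f_inv_into_f[of z g "{1..?r}"] g(2) by simp
  obtain w where w: "w \<in> perm ?r" "map g w = ?Z"
    using ex_perm_map[OF inj g(2)] permD(2)[OF perm] by auto
  have "map ?h ?Z = w"
  proof -
    have "map ?h (map g w) = w"
      unfolding map_map using inj permD(3)[OF w(1)] by (intro map_idI) simp
    then show ?thesis using w(2) by simp
  qed
  then have w_eq: "w = map (?h \<circ> f) u @ map ?h Y" by simp
  have fZ: "f c \<in> set ?Z" if "c \<in> {1..p}" for c using that permD(3)[OF u(1)] by simp
  have h_mono: "?h y < ?h z" if "y \<in> set ?Z" "z \<in> set ?Z" "y < z" for y z
  proof -
    have "?h y \<in> {1..?r}" "?h z \<in> {1..?r}" using that(1,2) g(2) inv_into_into by metis+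
    then show ?thesis
      using strict_mono_on_less[OF g(1)] gh that by metis
  qed
  have "strict_mono_on {1..p} (?h \<circ> f)"
  proof (rule strict_mono_onI)
    fix c d assume "c \<in> {1..p}" "d \<in> {1..p}" "c < d"
    then show "(?h \<circ> f) c < (?h \<circ> f) d"
      using h_mono fZ strict_mono_onD[OF f] by simp
  qed
  then have "(w, map (?h \<circ> f) u' @ map ?h Y) \<in> \<Theta> ?r"
    using insertional_right[OF ins eq uu, of "?h \<circ> f"] w(1) unfolding w_eq by blast
  then have *: "(X @ map g w, X @ map g (map (?h \<circ> f) u' @ map ?h Y)) \<in> \<Theta> n"
    by (rule insertional_left[OF ins eq _ g(1)]) (use perm w(2) in simp)
  have "map g (map (?h \<circ> f) u') = map f u'"
    unfolding map_map using gh fZ permD(3)[OF u(2)] by (intro map_cong) auto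
  moreover have "map g (map ?h Y) = Y"
    unfolding map_map using gh by (intro map_idI) simp
  ultimately have e: "map g (map (?h \<circ> f) u' @ map ?h Y) = map f u' @ Y"
    by (simp only: map_append)
  show ?thesis using * unfolding e w(2) .
qed

text \<open>Contraction only provides some lower cover \<open>y\<close>. The single descent forces
  \<open>y\<close> to lack the inversion (1, k), hence to lie below the swapped permutation, and
  being covered by \<gamma> leaves only equality.\<close>

lemma contracts_ji_swap:
  assumes "G @ k # 1 # H \<in> perm k" "descents (G @ k # 1 # H) = {length G}" "1 < k"
    and "contracts k \<Theta> (G @ k # 1 # H)"
  shows "(G @ k # 1 # H, G @ 1 # k # H) \<in> \<Theta>"
proof -
  let ?g = "G @ k # 1 # H" and ?g' = "G @ 1 # k # H"
  obtain y where y: "covered_by k y ?g" "(?g, y) \<in> \<Theta>"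
    using assms(4) by (auto simp: contracts_def)
  then have py: "y \<in> perm k" "wlt y ?g" by (auto simp: covered_by_def)
  obtain X b a Y where x: "?g = X @ b # a # Y" "a < b" "(a, b) \<notin> invs y"
    using ex_descent_not_inv[OF assms(1) py] .
  have "length X \<in> descents ?g"
    unfolding x(1) using x(2) by (auto simp: descents_def nth_append)
  then have "length X = length G" using assms(2) by simp
  then have "a = 1" "b = k" using x(1) by auto
  then have "invs y \<subseteq> invs ?g'"
    using py(2) x(3)
    unfolding wlt_def wle_def invs_swap(1)[OF permD(2)[OF assms(1)] assms(3)] by auto
  then have "wle y ?g'" by (simp add: wle_def)
  moreover have "?g' \<in> perm k" "wlt ?g' ?g"
    using covered_by_swap[OF assms(1,3)] by (simp_all add: covered_by_def)
  moreover have "\<not> (wlt y ?g' \<and> wlt ?g' ?g)"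
    using y(1) \<open>?g' \<in> perm k\<close> unfolding covered_by_def by blast
  ultimately have "y = ?g'" by (simp add: wlt_def)
  with y(2) show ?thesis by simp
qed

text \<open>The embedding extended by 1 to a and k to b. Every value strictly between a and b occurs
  in \<open>X\<close> or in \<open>Y\<close>, so matching letters means that \<open>G\<close> is
  sent into \<open>X\<close> and \<open>H\<close> into \<open>Y\<close>.\<close>

lemma embeds_split:
  assumes "\<gamma> = G @ k # 1 # H" "\<gamma> \<in> perm k" "1 < k" and x: "X @ b # a # Y \<in> perm n" and "a < b"
    "embeds \<gamma> a b (set X)" "left_values \<gamma> = set G"
  obtains F where "strict_mono_on {1..k} F" "F 1 = a" "F k = b"
    "F ` {1..k} = F ` set G \<union> F ` set H \<union> {a, b}"
    "set X \<inter> F ` {1..k} = F ` set G" "set Y \<inter> F ` {1..k} = F ` set H"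
proof -
  note g = assms(1,7) and pg = permD[OF assms(2)] and px = permD[OF x]
  obtain f where f: "strict_mono_on {1<..<k} f"
    "\<And>v. v \<in> {1<..<k} \<Longrightarrow> f v \<in> {a<..<b} \<and> (f v \<in> set X \<longleftrightarrow> v \<in> set G)"
    using assms(6) unfolding embeds_def pg(1) g(2) by blast
  define F where "F = f(1 := a, k := b)"
  have Ff: "F v = f v" if "v \<in> {1<..<k}" for v
    using that assms(3) by (auto simp: F_def)
  have F1: "F 1 = a" "F k = b" using assms(3) by (auto simp: F_def)
  have F_mono: "strict_mono_on {1..k} F"
  proof (rule strict_mono_onI)
    fix r s assume rs: "r \<in> {1..k}" "s \<in> {1..k}" "r < s"
    then consider "r = 1" "s = k" | "r = 1" "s \<in> {1<..<k}" | "r \<in> {1<..<k}" "s = k"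
      | "r \<in> {1<..<k}" "s \<in> {1<..<k}" by fastforce
    then show "F r < F s"
    proof cases
      case 1
      then show ?thesis using F1 assms(5) by simp
    next
      case 2
      then show ?thesis using F1 Ff f(2)[of s] by simp
    next
      case 3
      then show ?thesis using F1 Ff f(2)[of r] by simp
    next
      case 4
      then show ?thesis using Ff strict_mono_onD[OF f(1)] rs(3) by simp
    qed
  qed
  have mid: "v \<in> {1<..<k}" if "v \<in> set G \<union> set H" for v
  proof -
    have "v \<noteq> 1" "v \<noteq> k" "v \<in> {1..k}"
      using pg(2,3) that unfolding g(1) by auto
    then show ?thesis by auto
  qed
  have split: "{1..k} = set G \<union> set H \<union> {1, k}" using pg(3) unfolding g(1) by auto
  have GH: "set G \<inter> set H = {}" using pg(2) unfolding g(1) by auto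
  have ab: "a \<notin> set X" "b \<notin> set X" "a \<notin> set Y" "b \<notin> set Y" "set X \<inter> set Y = {}"
    using px(2) by auto
  have between: "c \<in> set X \<union> set Y" if "c \<in> {a<..<b}" for c
  proof -
    have "a \<in> {1..n}" "b \<in> {1..n}" unfolding px(3)[symmetric] by auto
    then have "c \<in> set (X @ b # a # Y)" unfolding px(3) using that by simp
    then show ?thesis using that by simp
  qed
  have FG: "F ` set G \<subseteq> set X"
  proof clarify
    fix v assume v: "v \<in> set G"
    then have "v \<in> {1<..<k}" using mid by blast
    then show "F v \<in> set X" using f(2)[of v] Ff[of v] v by simp
  qed
  have FH: "F ` set H \<subseteq> set Y"
  proof clarify
    fix v assume v: "v \<in> set H"
    then have "F v \<in> {a<..<b}" "F v \<notin> set X" using mid[of v] Ff[of v] f(2)[of v] GH by auto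
    then show "F v \<in> set Y" using between by blast
  qed
  let ?Z = "F ` {1..k}"
  have Z: "?Z = F ` set G \<union> F ` set H \<union> {a, b}"
    unfolding split image_Un image_insert F1 by auto
  have "set X \<inter> ?Z = F ` set G" "set Y \<inter> ?Z = F ` set H"
    unfolding Z using FG FH ab by blast+
  then show thesis using that F_mono F1 Z by blast
qed

lemma H_family_contracts_arc:
  assumes H: "H_family \<Theta>" and \<gamma>: "\<gamma> \<in> perm k" "join_irreducible \<gamma>" "untranslated \<gamma>"
    and con: "contracts k (\<Theta> k) \<gamma>"
    and x: "X @ b # a # Y \<in> perm n" "a < b" "embeds \<gamma> a b (set X)"
  shows "(X @ b # a # Y, X @ a # b # Y) \<in> \<Theta> n"
proof -
  obtain G H' where g: "\<gamma> = G @ k # 1 # H'" "descents \<gamma> = {length G}" "left_values \<gamma> = set G" "1 < k"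
    using untranslated_ji_form[OF \<gamma>] .
  let ?g = "G @ 1 # k # H'"
  note pg = permD[OF \<gamma>(1)] and px = permD[OF x(1)]
  have cong: "lattice_cong n (\<Theta> n)" for n
    using H by (simp add: H_family_def)
  have ins: "insertional \<Theta>" using H by (simp add: H_family_def)
  have eq: "equiv (perm n) (\<Theta> n)" for n using cong by (simp add: lattice_cong_def)
  have gg: "(\<gamma>, ?g) \<in> \<Theta> k"
    using contracts_ji_swap[of G k H' "\<Theta> k"] \<gamma>(1) con g by simp
  obtain F where F_mono: "strict_mono_on {1..k} F" and F1: "F 1 = a" "F k = b"
    and Z: "F ` {1..k} = F ` set G \<union> F ` set H' \<union> {a, b}"
    and XY: "set X \<inter> F ` {1..k} = F ` set G" "set Y \<inter> F ` {1..k} = F ` set H'"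
    by (rule embeds_split[OF g(1) \<gamma>(1) g(4) x g(3)])
  let ?Z = "F ` {1..k}"
  let ?X = "filter (\<lambda>c. c \<notin> ?Z) X" and ?Y = "filter (\<lambda>c. c \<notin> ?Z) Y"
  have ab: "a \<notin> set X" "b \<notin> set X" "a \<notin> set Y" "b \<notin> set Y" "set X \<inter> set Y = {}"
    using px(2) by auto
  have setX: "set (?X @ map F G) = set X" and setY: "set (map F H' @ ?Y) = set Y"
    using XY unfolding set_append set_filter set_map by blast+
  have inj: "inj_on F {1..k}" using F_mono strict_mono_on_imp_inj_on by blast
  have "inj_on F (set G)" "inj_on F (set H')"
    using inj pg(3) unfolding g(1) by (auto intro: inj_on_subset)
  moreover have "distinct G" "distinct H'" using pg(2) unfolding g(1) by simp_all
  ultimately have dist: "distinct (map F G)" "distinct (map F H')"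
    by (simp_all add: distinct_map)
  have "F ` set G \<subseteq> ?Z" "F ` set H' \<subseteq> ?Z" unfolding Z by blast+
  then have dist': "distinct (?X @ map F G)" "distinct (map F H' @ ?Y)"
    using dist px(2) by auto
  have perm': "(?X @ map F G) @ b # a # map F H' @ ?Y \<in> perm n"
  proof (rule permI)
    show "set ((?X @ map F G) @ b # a # map F H' @ ?Y) = {1..n}"
      unfolding px(3)[symmetric] set_append[of "?X @ map F G"] set_append[of X] set_simps setX setY ..
    show "distinct ((?X @ map F G) @ b # a # map F H' @ ?Y)"
      using dist' ab x(2) setX setY
      unfolding distinct_append[of "?X @ map F G"] distinct.simps set_simps by auto
  qed
  have "(?X @ map F \<gamma> @ ?Y, ?X @ map F ?g @ ?Y) \<in> \<Theta> n"
    by (rule insertional_both[OF ins eq gg F_mono])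
      (use perm' in \<open>simp add: g(1) F1 F1[unfolded One_nat_def]\<close>)
  then have "((?X @ map F G) @ b # a # map F H' @ ?Y, (?X @ map F G) @ a # b # map F H' @ ?Y) \<in> \<Theta> n"
    by (simp add: g(1) F1 F1[unfolded One_nat_def])
  then show ?thesis
    by (rule lattice_cong_same_sides[OF cong x(2,1) perm' setX])
qed

text \<open>The same lower cover, with b and a swapped, works for every H-family contracting
  \<open>C\<close>, hence for their intersection.\<close>

lemma arc_occurs_imp_contracts:
  assumes C: "\<forall>\<gamma> \<in> C. (\<exists>k. \<gamma> \<in> perm k) \<and> join_irreducible \<gamma> \<and> untranslated \<gamma>"
    and "x \<in> perm n" "\<gamma> \<in> C" "arc_occurs \<gamma> x"
  shows "contracts n (HC C n) x"
proof -
  obtain X b a Y where x: "x = X @ b # a # Y" "a < b" "embeds \<gamma> a b (set X)"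
    using assms(4) unfolding arc_occurs_def by blast
  have \<gamma>: "\<gamma> \<in> perm (length \<gamma>)" "join_irreducible \<gamma>" "untranslated \<gamma>"
    using C assms(3) permD(1) by metis+
  have "(x, X @ a # b # Y) \<in> \<Theta> n" if "H_family \<Theta>" "contracts_all \<Theta> C" for \<Theta>
    unfolding x(1)
  proof (rule H_family_contracts_arc[OF that(1) \<gamma>])
    show "contracts (length \<gamma>) (\<Theta> (length \<gamma>)) \<gamma>"
      using that(2) assms(3) unfolding contracts_all_def by blast
  qed (use assms(2) x in auto)
  then have "(x, X @ a # b # Y) \<in> HC C n" unfolding HC_def by blast
  moreover have "covered_by n (X @ a # b # Y) x"
    using covered_by_swap[of X b a Y n] assms(2) x by simp
  ultimately show ?thesis unfolding contracts_def by blast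
qed

section \<open>Scrambles\<close>

lemma nth_in_set_take:
  assumes "distinct x" "p < length x" "t \<le> length x"
  shows "x ! p \<in> set (take t x) \<longleftrightarrow> p < t"
proof
  assume "x ! p \<in> set (take t x)"
  then obtain r where "r < t" "x ! r = x ! p" using assms(3) by (auto simp: in_set_conv_nth)
  then show "p < t" using assms nth_eq_iff_index_eq[of x r p] by auto
next
  assume "p < t"
  then show "x ! p \<in> set (take t x)"
    using assms by (metis in_set_conv_nth length_take min.absorb2 nth_take)
qed

text \<open>The embedding sends v to the entry of \<open>x\<close> playing the role of v in the
  pattern. That entry is left of the cliff exactly when v is left of k in \<sigma>, and a scramble
  has the same values there as \<gamma>.\<close>

lemma scramble_occurs_imp_arc_occurs:
  assumes \<gamma>: "\<gamma> \<in> perm k" "join_irreducible \<gamma>" "untranslated \<gamma>" and x: "x \<in> perm n"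
    and scr: "scramble \<gamma> \<sigma>" and occ: "occurs_adj_cliff \<sigma> x"
  shows "arc_occurs \<gamma> x"
proof -
  obtain G H where g: "\<gamma> = G @ k # 1 # H" "descents \<gamma> = {length G}" "left_values \<gamma> = set G" "1 < k"
    using untranslated_ji_form[OF \<gamma>] .
  let ?m = "length G"
  note pg = permD[OF \<gamma>(1)] and px = permD[OF x]
  have m: "Suc ?m < k" using pg(1) unfolding g(1) by simp
  obtain j where \<sigma>: "\<sigma> \<in> perm k" and j: "j - 1 \<in> descents \<gamma>" "1 \<le> j"
    "\<sigma> ! (j - 1) = k" "\<sigma> ! j = 1" "set (take (j - 1) \<sigma>) = set (take (j - 1) \<gamma>)"
    using scr unfolding scramble_def Let_def pg(1) by blast
  note ps = permD[OF \<sigma>]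
  have "j = Suc ?m" using j(1,2) g(2) by simp
  have take_\<gamma>: "take ?m \<gamma> = G" by (simp add: g(1))
  have s: "\<sigma> ! ?m = k" "\<sigma> ! Suc ?m = 1" "set (take ?m \<sigma>) = set G"
    using j(3-5) unfolding \<open>j = Suc ?m\<close> diff_Suc_1 take_\<gamma> .
  obtain j' i where j': "1 \<le> j'" "j' < k" "\<sigma> ! (j' - 1) = k"
    and i': "\<forall>p q. p < q \<and> q < k \<longrightarrow> i p < i q" "\<forall>p < k. i p < length x"
      "\<forall>p < k. \<forall>q < k. x ! i p < x ! i q \<longleftrightarrow> \<sigma> ! p < \<sigma> ! q"
      "i j' = Suc (i (j' - 1))"
    using occ unfolding occurs_adj_cliff_def Let_def ps(1) by (elim exE conjE)
  have i: "\<And>p q. p < q \<Longrightarrow> q < k \<Longrightarrow> i p < i q" "\<And>p. p < k \<Longrightarrow> i p < length x"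
    "\<And>p q. p < k \<Longrightarrow> q < k \<Longrightarrow> x ! i p < x ! i q \<longleftrightarrow> \<sigma> ! p < \<sigma> ! q"
    using i'(1-3) by simp_all
  \<comment> \<open>The indices from the scramble and from the occurrence are chosen separately;
    both locate the value k in the distinct list \<sigma>, so they agree.\<close>
  have "j' - 1 = ?m"
    using s(1) j' m ps nth_eq_iff_index_eq[of \<sigma> "j' - 1" ?m] by simp
  then have "j' = Suc ?m" using j'(1) by simp
  then have i_Suc: "i (Suc ?m) = Suc (i ?m)" using i'(4) by simp
  let ?X = "take (i ?m) x" and ?b = "x ! i ?m" and ?a = "x ! i (Suc ?m)"
  have "Suc (i ?m) < length x" using i(2)[OF m] i_Suc by simp
  then have x_eq: "x = ?X @ ?b # ?a # drop (Suc (Suc (i ?m))) x"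
    unfolding i_Suc by (simp add: Cons_nth_drop_Suc)
  have "?a < ?b" using i(3)[of "Suc ?m" ?m] m s(1,2) g(4) by simp
  define pos where "pos v = (SOME p. p < k \<and> \<sigma> ! p = v)" for v
  have pos: "pos v < k" "\<sigma> ! pos v = v" if "v \<in> {1..k}" for v
  proof -
    have "\<exists>p. p < k \<and> \<sigma> ! p = v" using that ps(1) unfolding ps(3)[symmetric] in_set_conv_nth by auto
    then show "pos v < k" "\<sigma> ! pos v = v" unfolding pos_def by (metis (mono_tags, lifting) someI_ex)+
  qed
  have mono: "x ! i (pos v) < x ! i (pos w) \<longleftrightarrow> v < w" if "v \<in> {1..k}" "w \<in> {1..k}" for v w
    using i(3) pos[OF that(1)] pos[OF that(2)] by simp
  have "?b = x ! i (pos k)" "?a = x ! i (pos 1)"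
    using pos[of k] pos[of 1] g(4) s m ps nth_eq_iff_index_eq[of \<sigma> "pos k" ?m]
      nth_eq_iff_index_eq[of \<sigma> "pos 1" "Suc ?m"] by auto
  then have between: "x ! i (pos v) \<in> {?a<..<?b}" if "v \<in> {1<..<k}" for v
    using mono[of 1 v] mono[of v k] that by simp
  have left: "x ! i (pos v) \<in> set ?X \<longleftrightarrow> v \<in> left_values \<gamma>" if "v \<in> {1<..<k}" for v
  proof -
    have v: "v \<in> {1..k}" using that by simp
    have "x ! i (pos v) \<in> set ?X \<longleftrightarrow> i (pos v) < i ?m"
      using px i(2)[OF pos(1)[OF v]] i(2)[of ?m] m by (intro nth_in_set_take) auto
    also have "\<dots> \<longleftrightarrow> pos v < ?m"
      using i(1)[of "pos v" ?m] i(1)[of ?m "pos v"] pos(1)[OF v] m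
      by (cases "pos v" ?m rule: linorder_cases) auto
    also have "\<dots> \<longleftrightarrow> \<sigma> ! pos v \<in> set (take ?m \<sigma>)"
      using ps pos(1)[OF v] m by (intro nth_in_set_take[symmetric]) auto
    finally show ?thesis unfolding s(3) g(3) pos(2)[OF v] .
  qed
  have "strict_mono_on {1<..<k} (\<lambda>v. x ! i (pos v))"
    by (rule strict_mono_onI) (use mono in simp)
  then have "embeds \<gamma> ?a ?b (set ?X)"
    unfolding embeds_def pg(1) using between left by blast
  then show ?thesis
    unfolding arc_occurs_def using x_eq \<open>?a < ?b\<close> by blast
qed

lemma arc_occurs_imp_scramble_occurs:
  assumes \<gamma>: "\<gamma> \<in> perm k" "join_irreducible \<gamma>" "untranslated \<gamma>" and x: "x \<in> perm n"
    and occ: "arc_occurs \<gamma> x"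
  obtains \<sigma> where "scramble \<gamma> \<sigma>" "occurs_adj_cliff \<sigma> x"
proof -
  obtain G H where g: "\<gamma> = G @ k # 1 # H" "descents \<gamma> = {length G}" "left_values \<gamma> = set G" "1 < k"
    using untranslated_ji_form[OF \<gamma>] .
  let ?m = "length G"
  note pg = permD[OF \<gamma>(1)] and px = permD[OF x]
  have m: "Suc ?m < k" using pg(1) unfolding g(1) by simp
  obtain X b a Y where xe: "x = X @ b # a # Y" "a < b" "embeds \<gamma> a b (set X)"
    using occ unfolding arc_occurs_def by blast
  obtain F where F: "strict_mono_on {1..k} F" "F 1 = a" "F k = b"
    and Z: "F ` {1..k} = F ` set G \<union> F ` set H \<union> {a, b}"
    and XY: "set X \<inter> F ` {1..k} = F ` set G" "set Y \<inter> F ` {1..k} = F ` set H"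
    by (rule embeds_split[OF g(1) \<gamma>(1) g(4) x[unfolded xe(1)] xe(2,3) g(3)])
  let ?Z = "F ` {1..k}" and ?h = "inv_into {1..k} F"
  have inj: "inj_on F {1..k}" using F(1) strict_mono_on_imp_inj_on by blast
  have hF: "?h (F v) = v" if "v \<in> {1..k}" for v using inv_into_f_f[OF inj that] .
  have h_less: "?h y < ?h z \<longleftrightarrow> y < z" if "y \<in> ?Z" "z \<in> ?Z" for y z
    using that hF strict_mono_on_less[OF F(1)] by (auto simp del: atLeastAtMost_iff)
  let ?xZ = "filter (\<lambda>c. c \<in> ?Z) x" and ?XZ = "filter (\<lambda>c. c \<in> ?Z) X" and ?YZ = "filter (\<lambda>c. c \<in> ?Z) Y"
  have "a \<in> ?Z" "b \<in> ?Z" unfolding Z by auto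
  then have xZ: "?xZ = ?XZ @ b # a # ?YZ" unfolding xe(1) by simp
  have G_sub: "set G \<subseteq> {1..k}" unfolding pg(3)[symmetric] g(1) by auto
  have setXZ: "set ?XZ = F ` set G" using XY(1) by auto
  have "distinct ?XZ" using px(2) unfolding xe(1) by simp
  then have "length ?XZ = card (F ` set G)" using setXZ distinct_card by metis
  also have "\<dots> = card (set G)" using inj G_sub by (intro card_image) (rule inj_on_subset)
  also have "\<dots> = ?m" using pg(2) unfolding g(1) by (simp add: distinct_card)
  finally have len: "length ?XZ = ?m" .
  have setYZ: "set ?YZ = F ` set H" using XY(2) by auto
  have setZ: "set ?xZ = ?Z"
    unfolding xZ set_append set_simps setXZ setYZ unfolding Z by auto
  define \<sigma> where "\<sigma> = map ?h ?xZ"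
  have \<sigma>: "\<sigma> \<in> perm k"
  proof (rule permI)
    show "set \<sigma> = {1..k}"
      unfolding \<sigma>_def set_map setZ by (rule inv_into_image_cancel[OF inj subset_refl])
    have "inj_on ?h ?Z" by (rule inj_on_inv_into) (rule subset_refl)
    then show "distinct \<sigma>" unfolding \<sigma>_def distinct_map setZ using px(2) by simp
  qed
  note ps = permD[OF \<sigma>]
  have \<sigma>_eq: "\<sigma> = map ?h ?XZ @ k # 1 # map ?h ?YZ"
    unfolding \<sigma>_def xZ using hF[of 1] hF[of k] F(2,3) g(4) by simp
  have s: "\<sigma> ! ?m = k" "\<sigma> ! Suc ?m = 1" "take ?m \<sigma> = map ?h ?XZ"
    unfolding \<sigma>_eq using len by (simp_all add: nth_append)
  have "?h ` F ` set G = set G" by (rule inv_into_image_cancel[OF inj G_sub])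
  then have "set (take ?m \<sigma>) = set (take ?m \<gamma>)" unfolding s(3) set_map setXZ by (simp add: g(1))
  then have scr: "scramble \<gamma> \<sigma>"
    unfolding scramble_def Let_def pg(1)
    using \<sigma> s g(2) by (intro conjI exI[of _ "Suc ?m"]) simp_all
  \<comment> \<open>The positions of the kept entries in increasing order; \<open>(!) ids\<close> is
    the position map of the occurrence.\<close>
  define ids where "ids = filter (\<lambda>t. x ! t \<in> ?Z) [0..<length x]"
  have ids_map: "map ((!) x) ids = ?xZ"
  proof -
    have "?xZ = filter (\<lambda>c. c \<in> ?Z) (map ((!) x) [0..<length x])" by (simp only: map_nth)
    then show ?thesis unfolding ids_def filter_map o_def by simp
  qed
  have len_ids: "length ids = k" using ps(1) ids_map unfolding \<sigma>_def by (metis length_map)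
  have nth_ids: "x ! (ids ! p) = ?xZ ! p" "ids ! p < length x" if "p < k" for p
  proof -
    show "x ! (ids ! p) = ?xZ ! p" using ids_map len_ids that by (metis nth_map)
    have "ids ! p \<in> set ids" using len_ids that by simp
    then show "ids ! p < length x" unfolding ids_def by simp
  qed
  have len_xZ: "length ?xZ = k" using len_ids ids_map by (metis length_map)
  have "sorted_wrt (<) ids" unfolding ids_def by (intro sorted_wrt_filter sorted_wrt_upt)
  then have mono: "ids ! p < ids ! q" if "p < q" "q < k" for p q
    using that len_ids by (simp add: sorted_wrt_iff_nth_less)
  have ord: "x ! (ids ! p) < x ! (ids ! q) \<longleftrightarrow> \<sigma> ! p < \<sigma> ! q" if "p < k" "q < k" for p q
  proof -
    have "?xZ ! p \<in> ?Z" "?xZ ! q \<in> ?Z" using that len_xZ setZ nth_mem by metis+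
    then show ?thesis using that nth_ids h_less len_xZ unfolding \<sigma>_def by simp
  qed
  \<comment> \<open>The kept entries number \<open>?m\<close> and \<open>Suc ?m\<close> are b and a.
    Distinctness of \<open>x\<close> turns equal entries into equal positions, which gives
    adjacency.\<close>
  have "x ! (ids ! ?m) = x ! length X" "x ! (ids ! Suc ?m) = x ! Suc (length X)"
    using nth_ids[of ?m] nth_ids[of "Suc ?m"] m len unfolding xZ by (simp_all add: nth_append xe(1))
  moreover have "Suc (length X) < length x" unfolding xe(1) by simp
  ultimately have "ids ! ?m = length X" "ids ! Suc ?m = Suc (length X)"
    using nth_eq_iff_index_eq[OF px(2)] nth_ids(2)[of ?m] nth_ids(2)[of "Suc ?m"] m
    by (metis Suc_lessD)+
  then have adj: "ids ! Suc ?m = Suc (ids ! (Suc ?m - 1))" by simp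
  have "occurs_adj_cliff \<sigma> x"
    unfolding occurs_adj_cliff_def Let_def ps(1)
    using s m mono nth_ids(2) ord adj
    by (intro exI[of _ "Suc ?m"] conjI exI[of _ "(!) ids"]) simp_all
  with scr show thesis by (rule that)
qed

theorem theorem9p3:
  fixes C :: "nat list set" and n :: nat and x :: "nat list"
  assumes "\<forall>\<gamma> \<in> C. (\<exists>k. \<gamma> \<in> perm k) \<and> join_irreducible \<gamma> \<and> untranslated \<gamma>"
    and "x \<in> perm n"
  shows "contracts n (HC C n) x \<longleftrightarrow> (\<exists>\<gamma> \<in> C. \<exists>\<sigma>. scramble \<gamma> \<sigma> \<and> occurs_adj_cliff \<sigma> x)"
proof
  assume "contracts n (HC C n) x"
  then obtain \<gamma> where "\<gamma> \<in> C" "arc_occurs \<gamma> x"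
    using contracts_imp_arc_occurs[OF assms(1)] by blast
  moreover obtain k where "\<gamma> \<in> perm k" "join_irreducible \<gamma>" "untranslated \<gamma>"
    using assms(1) \<open>\<gamma> \<in> C\<close> by blast
  ultimately show "\<exists>\<gamma> \<in> C. \<exists>\<sigma>. scramble \<gamma> \<sigma> \<and> occurs_adj_cliff \<sigma> x"
    using arc_occurs_imp_scramble_occurs assms(2) by metis
next
  assume "\<exists>\<gamma> \<in> C. \<exists>\<sigma>. scramble \<gamma> \<sigma> \<and> occurs_adj_cliff \<sigma> x"
  then obtain \<gamma> \<sigma> where "\<gamma> \<in> C" "scramble \<gamma> \<sigma>" "occurs_adj_cliff \<sigma> x" by blast
  then have "arc_occurs \<gamma> x"
    using assms scramble_occurs_imp_arc_occurs by blast
  with \<open>\<gamma> \<in> C\<close> show "contracts n (HC C n) x"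
    using arc_occurs_imp_contracts[OF assms] by blast
qed

end
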